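(* Let $n\ge1$, let $f\in C^2(\mathbb{S}^1)$ be non-constant, and consider on $\mathbb{R}^n\times\mathbb{T}^n$ the Hamiltonian $$H(I_1,\dots,I_n,\varphi_1,\dots,\varphi_n)=\sum_{j=1}^n\frac{I_j^2}{2}+f(\varphi_1).$$ Let $c(\cdot)$, $E_1(k)$, $E_2(k)$ be as in the context (with $E_1,E_2$ built from $u_k^{(n)},\sigma_k^{(n)},\bar H_k^{(n)}$), and let $R>0$ be such that $c(R)>\max f$. (a) There exist constants $c_R>0$ and $C_R>0$ such that, for all sufficiently large $k$, $$\frac{c_R}{k^2}\le E_1(k)\le\frac{C_R}{k}.$$ (b) There exists a constant $C^R>0$ and, for every $\tilde I\in\mathbb{R}^n$ with $|\tilde I|\le R$, $\tilde I_1>0$ and $c(\tilde I_1)>\max f$, a constant $c_{\tilde I}>0$ such that, for all sufficiently large $k$, $$\frac{c_{\tilde I}}{k^2}\le E_2(k)\le\frac{C^R}{k}.$$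
   Context: $\mathbb{S}^1=\mathbb{R}/2\pi\mathbb{Z}$, $\mathbb{T}^n=(\mathbb{S}^1)^n$; $k\ge1$ is an integer. $W:[0,+\infty)\to[0,+\infty)$ is the (real, increasing) Lambert function, $z=W(z)e^{W(z)}$. For $c\in\mathbb{R}$, $\varphi\in\mathbb{S}^1$: $\gamma_k(c,\varphi):=\sqrt{\frac{W(e^{2(c-f(\varphi))k}k)}{k}}$; $\gamma_0(c,\varphi):=\sqrt{2(c-f(\varphi))}$ if $c>f(\varphi)$ and $0$ otherwise. For $J>0$, $c_k(J)$ is the unique real $c$ with $J=\frac1{2\pi}\int_0^{2\pi}\gamma_k(c,\varphi)d\varphi$, and $c(J)$ is the unique real $c$ with $J=\frac1{2\pi}\int_0^{2\pi}\gamma_0(c,\varphi)d\varphi$. One-dimensional objects. For $J>0$ (and $\varphi$ represented in $[0,2\pi]$): $$u_k^{(1)}(J,\varphi):=J(\pi-\varphi)-\frac1{2\pi}\int_0^{2\pi}\!\!\int_0^y\gamma_k(c_k(J),x)\,dx\,dy+\int_0^\varphi\gamma_k(c_k(J),x)\,dx,$$ $$\sigma_k^{(1)}(J,\varphi):=\frac{1/\gamma_k(c_k(J),\varphi)}{\int_0^{2\pi}\frac{dx}{\gamma_k(c_k(J),x)}},\qquad \bar H_k^{(1)}(J):=c_k(J)+\frac1k\log\int_0^{2\pi}\frac{d\varphi}{\gamma_k(c_k(J),\varphi)};$$ for $J<0$: $u_k^{(1)}(J,\varphi):=-u_k^{(1)}(|J|,\varphi)$, $\sigma_k^{(1)}(J,\varphi):=\sigma_k^{(1)}(|J|,\varphi)$,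 $\bar H_k^{(1)}(J):=\bar H_k^{(1)}(|J|)$. $n$-dimensional objects: $u_k^{(n)}(\tilde I,\varphi):=u_k^{(1)}(\tilde I_1,\varphi_1)$, $\sigma_k^{(n)}(\tilde I,\varphi):=\sigma_k^{(1)}(\tilde I_1,\varphi_1)$, $\bar H_k^{(n)}(\tilde I):=\bar H_k^{(1)}(\tilde I_1)+\sum_{j=2}^n\tilde I_j^2/2$ (the null set $\tilde I_1=0$ is irrelevant). The integrals are $$E_1(k)=\int_{|\tilde I|\le R}\int_{\mathbb{T}^n}\Big|\frac{\partial}{\partial\tilde I}\Big[\tfrac12\Big|\tilde I+\frac{\partial u_k^{(n)}}{\partial\varphi}\Big|^2-\bar H_k^{(n)}(\tilde I)\Big]\Big|^2\sigma_k^{(n)}\,d\varphi\,d\tilde I,$$ $$E_2(k)=\int_{\mathbb{T}^n}\Big|\frac{\partial}{\partial\varphi}\Big[\tfrac12\Big|\tilde I+\frac{\partial u_k^{(n)}}{\partial\varphi}\Big|^2+f(\varphi_1)\Big]\Big|^2\sigma_k^{(n)}\,d\varphi ,$$ where $\tilde I\in\mathbb{R}^n$, $|\cdot|$ is the Euclidean norm, $\partial/\partial\tilde I$ and $\partial/\partial\varphi$ are gradients; $E_1(k)$ depends on $R$ and $E_2(k)$ on $\tilde I$. The upper bounds are those of Evans' general theory; the lower bounds come from the one-dimensional case. *)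

theory Defs
  imports "HOL-Analysis.Analysis"
begin

definition lambert_W :: "real \<Rightarrow> real" where
  "lambert_W z = (THE w. 0 \<le> w \<and> w * exp w = z)"

text \<open>
  Functions on the circle are \<open>2 * pi\<close>-periodic functions on the real line.
\<close>

definition C2_circle :: "(real \<Rightarrow> real) \<Rightarrow> bool" where
  "C2_circle f \<longleftrightarrow> (\<forall>x. f (x + 2 * pi) = f x) \<and>
     f C1_differentiable_on UNIV \<and> deriv f C1_differentiable_on UNIV"

definition gamma :: "(real \<Rightarrow> real) \<Rightarrow> nat \<Rightarrow> real \<Rightarrow> real \<Rightarrow> real" where
  "gamma f k c \<phi> = sqrt (lambert_W (exp (2 * (c - f \<phi>) * real k) * real k) / real k)"

definition gamma0 :: "(real \<Rightarrow> real) \<Rightarrow> real \<Rightarrow> real \<Rightarrow> real" where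
  "gamma0 f c \<phi> = (if f \<phi> < c then sqrt (2 * (c - f \<phi>)) else 0)"

definition c_approx :: "(real \<Rightarrow> real) \<Rightarrow> nat \<Rightarrow> real \<Rightarrow> real" where
  "c_approx f k J = (THE c. J = 1 / (2 * pi) * (LBINT \<phi>=ereal 0..ereal (2 * pi). gamma f k c \<phi>))"

definition c_limit :: "(real \<Rightarrow> real) \<Rightarrow> real \<Rightarrow> real" where
  "c_limit f J = (THE c. J = 1 / (2 * pi) * (LBINT \<phi>=ereal 0..ereal (2 * pi). gamma0 f c \<phi>))"

text \<open>
  The interval integrals are oriented, so the formula below makes sense for every real \<open>\<phi>\<close>.
  For \<open>J > 0\<close> the mean of \<open>gamma f k (c_approx f k J)\<close> is \<open>J\<close>, hence the function is
  \<open>2 * pi\<close>-periodic in \<open>\<phi>\<close>.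
\<close>

definition u1_pos :: "(real \<Rightarrow> real) \<Rightarrow> nat \<Rightarrow> real \<Rightarrow> real \<Rightarrow> real" where
  "u1_pos f k J \<phi> =
     J * (pi - \<phi>)
     - 1 / (2 * pi) * (LBINT y=ereal 0..ereal (2 * pi).
         (LBINT x=ereal 0..ereal y. gamma f k (c_approx f k J) x))
     + (LBINT x=ereal 0..ereal \<phi>. gamma f k (c_approx f k J) x)"

text \<open>
  The values of the next three functions at \<open>J = 0\<close> are irrelevant: they only enter
  through a null set of momenta.
\<close>

definition u1 :: "(real \<Rightarrow> real) \<Rightarrow> nat \<Rightarrow> real \<Rightarrow> real \<Rightarrow> real" where
  "u1 f k J \<phi> = (if J < 0 then - u1_pos f k \<bar>J\<bar> \<phi> else u1_pos f k J \<phi>)"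

definition sigma1 :: "(real \<Rightarrow> real) \<Rightarrow> nat \<Rightarrow> real \<Rightarrow> real \<Rightarrow> real" where
  "sigma1 f k J \<phi> =
     (1 / gamma f k (c_approx f k \<bar>J\<bar>) \<phi>)
     / (LBINT x=ereal 0..ereal (2 * pi). 1 / gamma f k (c_approx f k \<bar>J\<bar>) x)"

definition Hbar1 :: "(real \<Rightarrow> real) \<Rightarrow> nat \<Rightarrow> real \<Rightarrow> real" where
  "Hbar1 f k J =
     c_approx f k \<bar>J\<bar>
     + 1 / real k * ln (LBINT \<phi>=ereal 0..ereal (2 * pi). 1 / gamma f k (c_approx f k \<bar>J\<bar>) \<phi>)"

text \<open>
  The space of dimension \<open>n \<ge> 1\<close> is \<open>real ^ 'n\<close>, and \<open>i1 :: 'n\<close> is the index of the first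
  coordinate.
\<close>

definition u_n :: "(real \<Rightarrow> real) \<Rightarrow> 'n::finite \<Rightarrow> nat \<Rightarrow> real ^ 'n \<Rightarrow> real ^ 'n \<Rightarrow> real" where
  "u_n f i1 k I \<phi> = u1 f k (I $ i1) (\<phi> $ i1)"

definition sigma_n :: "(real \<Rightarrow> real) \<Rightarrow> 'n::finite \<Rightarrow> nat \<Rightarrow> real ^ 'n \<Rightarrow> real ^ 'n \<Rightarrow> real" where
  "sigma_n f i1 k I \<phi> = sigma1 f k (I $ i1) (\<phi> $ i1)"

definition Hbar_n :: "(real \<Rightarrow> real) \<Rightarrow> 'n::finite \<Rightarrow> nat \<Rightarrow> real ^ 'n \<Rightarrow> real" where
  "Hbar_n f i1 k I = Hbar1 f k (I $ i1) + (\<Sum>j\<in>UNIV - {i1}. (I $ j)\<^sup>2 / 2)"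

definition grad :: "(real ^ 'n::finite \<Rightarrow> real) \<Rightarrow> real ^ 'n \<Rightarrow> real ^ 'n" where
  "grad g x = (THE D. GDERIV g x :> D)"

text \<open>A fundamental domain of the torus, with Lebesgue measure.\<close>

definition torus :: "(real ^ 'n::finite) set" where
  "torus = {\<phi>. \<forall>j. 0 \<le> \<phi> $ j \<and> \<phi> $ j \<le> 2 * pi}"

text \<open>
  The integrands of \<open>E1\<close> and \<open>E2\<close> are nonnegative; the integrals take values in \<open>[0, \<infinity>]\<close>, so
  an upper bound includes finiteness.
\<close>

definition E1 :: "(real \<Rightarrow> real) \<Rightarrow> 'n::finite \<Rightarrow> real \<Rightarrow> nat \<Rightarrow> ennreal" where
  "E1 f i1 R k =
     (\<integral>\<^sup>+I\<in>{I :: real ^ 'n. norm I \<le> R}.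
       (\<integral>\<^sup>+\<phi>\<in>torus.
          ennreal ((norm (grad (\<lambda>I. 1 / 2 * (norm (I + grad (u_n f i1 k I) \<phi>))\<^sup>2 - Hbar_n f i1 k I) I))\<^sup>2
            * sigma_n f i1 k I \<phi>) \<partial>lborel) \<partial>lborel)"

definition E2 :: "(real \<Rightarrow> real) \<Rightarrow> 'n::finite \<Rightarrow> real ^ 'n \<Rightarrow> nat \<Rightarrow> ennreal" where
  "E2 f i1 I k =
     (\<integral>\<^sup>+\<phi>\<in>torus.
        ennreal ((norm (grad (\<lambda>\<phi>. 1 / 2 * (norm (I + grad (u_n f i1 k I) \<phi>))\<^sup>2 + f (\<phi> $ i1)) \<phi>))\<^sup>2
          * sigma_n f i1 k I \<phi>) \<partial>lborel)"

end

theory Submission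
  imports Defs "HOL-Complex_Analysis.Conformal_Mappings"
begin

text \<open>
  \<open>gamma f k c x\<close> is the positive root of \<open>\<gamma>\<^sup>2 / 2 + ln \<gamma> / k = c - f x\<close>. Put
  \<open>w = 1 / (\<gamma>\<^sup>2 + 1 / k)\<close>, \<open>A = \<integral> 1 / \<gamma>\<close>, \<open>B = \<integral> \<gamma> w\<close> and \<open>D = \<integral> w / \<gamma>\<close>. Since \<open>I + \<partial>u / \<partial>\<phi>\<close>
  has first coordinate \<open>\<plusminus> \<gamma>\<close> and \<open>dc / dJ = 2 pi / B\<close>, the two gradients have only a first coordinate,
  namely \<open>- (2 pi / (k B)) (w - D / A)\<close> up to sign and \<open>f' w / k\<close>. So \<open>E1\<close> is \<open>1 / k\<^sup>2\<close> times an
  integrated variance of \<open>w\<close> with respect to \<open>\<sigma> = 1 / (\<gamma> A)\<close>. As \<open>w \<le> k\<close>, it is at most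
  \<open>1 / k\<close> times the integral of the derivative of \<open>2 pi / A\<close>, and \<open>2 pi / A \<le> J\<close> by convexity.
  For the lower bounds, \<open>\<gamma>\<close> stays between positive constants, uniformly in large \<open>k\<close>, for momenta
  slightly below one whose limiting energy exceeds \<open>max f\<close>; then the variance of \<open>w\<close> is bounded
  below because \<open>f\<close> is not constant.
\<close>

section \<open>The regularised square root\<close>

text \<open>The inverse of \<open>energy k\<close> on the positive half line. It replaces the square
  root of \<open>2 * s\<close> by a positive function that is differentiable at every real
  \<open>s\<close>, and it isolates the dependence of \<open>gamma\<close> on the single variable
  \<open>c - f \<phi>\<close>.\<close>

definition soft_sqrt :: "nat \<Rightarrow> real \<Rightarrow> real" where
  "soft_sqrt k s = sqrt (lambert_W (exp (2 * s * real k) * real k) / real k)"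

definition energy :: "nat \<Rightarrow> real \<Rightarrow> real" where
  "energy k x = x\<^sup>2 / 2 + ln x / real k"

lemma gamma_eq_soft_sqrt: "gamma f k c \<phi> = soft_sqrt k (c - f \<phi>)"
  by (simp add: gamma_def soft_sqrt_def)

lemma mult_exp_strict_mono:
  fixes v w :: real
  assumes "0 \<le> v" "v < w"
  shows "v * exp v < w * exp w"
  using assms by (intro mult_strict_mono') auto

text \<open>Strict monotonicity gives uniqueness of the root. The later arguments of
  \<open>lambert_W\<close> are brought to the form \<open>w * exp w\<close>, which exhibits the root
  explicitly.\<close>

lemma lambert_W_mult_exp:
  assumes "0 \<le> w"
  shows "lambert_W (w * exp w) = w"
  unfolding lambert_W_def
proof (rule the_equality)
  fix v :: real
  assume "0 \<le> v \<and> v * exp v = w * exp w"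
  with assms show "v = w"
    using mult_exp_strict_mono[of v w] mult_exp_strict_mono[of w v] by linarith
qed (use assms in auto)

text \<open>For \<open>s = energy k x\<close> the exponential turns the logarithm into the factor
  \<open>x\<^sup>2\<close>, so the argument of \<open>lambert_W\<close> is \<open>w * exp w\<close>
  with \<open>w = k * x\<^sup>2\<close>.\<close>

lemma soft_sqrt_energy:
  assumes k: "0 < k" and x: "0 < x"
  shows "soft_sqrt k (energy k x) = x"
proof -
  have "exp (2 * energy k x * real k) = exp (real k * x\<^sup>2) * exp (ln x + ln x)"
    using k by (simp add: energy_def algebra_simps add_divide_distrib flip: exp_add)
  also have "\<dots> = exp (real k * x\<^sup>2) * x\<^sup>2"
    using x by (simp only: exp_add exp_ln power2_eq_square)
  finally have "exp (2 * energy k x * real k) * real k = (real k * x\<^sup>2) * exp (real k * x\<^sup>2)"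
    by simp
  then show ?thesis
    using k x by (simp only: soft_sqrt_def) (simp add: lambert_W_mult_exp)
qed

lemma energy_strict_mono:
  assumes "0 < k" "0 < x" "x < y"
  shows "energy k x < energy k y"
  unfolding energy_def using assms
  by (intro add_strict_mono divide_strict_right_mono power_strict_mono) auto

lemma DERIV_energy:
  assumes "0 < k" "0 < x"
  shows "(energy k has_real_derivative (x + 1 / (real k * x))) (at x)"
  unfolding energy_def [abs_def] using assms
  by (auto intro!: derivative_eq_intros)

lemma continuous_on_energy: "continuous_on {0<..} (energy k)"
  unfolding energy_def [abs_def] by (cases "k = 0") (auto intro!: continuous_intros)

lemma energy_surj:
  assumes k: "0 < k"
  obtains x where "0 < x" "energy k x = s"
proof -
  \<comment> \<open>At \<open>a\<close> the logarithmic term is at most \<open>s - 1\<close> and the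
    quadratic term at most \<open>1\<close>; at \<open>b\<close> the logarithm is nonnegative and
    \<open>b\<^sup>2 \<ge> b \<ge> 2 * \<bar>s\<bar>\<close>.\<close>
  define a where "a = min 1 (exp (real k * (s - 1)))"
  define b where "b = max 1 (2 * \<bar>s\<bar>)"
  have a: "0 < a" "a \<le> 1" and b: "1 \<le> b" "2 * \<bar>s\<bar> \<le> b"
    by (auto simp: a_def b_def)
  have "ln a \<le> real k * (s - 1)"
    using a ln_mono[of a "exp (real k * (s - 1))"] by (simp add: a_def)
  then have "ln a / real k \<le> s - 1"
    using k by (simp add: field_simps)
  moreover have "a\<^sup>2 / 2 \<le> 1"
    using a power_le_one[of a 2] by simp
  ultimately have "energy k a \<le> s"
    by (simp add: energy_def)
  moreover have "s \<le> energy k b"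
  proof -
    have "b \<le> b\<^sup>2"
      using b by (simp add: self_le_power)
    moreover have "0 \<le> ln b / real k"
      using b by simp
    ultimately show ?thesis
      using b unfolding energy_def by linarith
  qed
  moreover have "continuous_on {a..b} (energy k)"
    by (rule continuous_on_subset[OF continuous_on_energy]) (use a in auto)
  ultimately obtain x where "a \<le> x" "x \<le> b" "energy k x = s"
    using IVT'[of "energy k" a s b] a b by auto
  then show ?thesis
    using that[of x] a by auto
qed

lemma soft_sqrt_pos:
  assumes "0 < k"
  shows "0 < soft_sqrt k s"
  by (metis assms energy_surj soft_sqrt_energy)

lemma energy_soft_sqrt:
  assumes "0 < k"
  shows "energy k (soft_sqrt k s) = s"
  by (metis assms energy_surj soft_sqrt_energy)

lemma soft_sqrt_less_iff:
  assumes "0 < k" "0 < x"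
  shows "soft_sqrt k s < x \<longleftrightarrow> s < energy k x"
  by (metis assms energy_soft_sqrt energy_strict_mono not_less_iff_gr_or_eq soft_sqrt_energy soft_sqrt_pos)

lemma soft_sqrt_le_iff:
  assumes "0 < k" "0 < x"
  shows "soft_sqrt k s \<le> x \<longleftrightarrow> s \<le> energy k x"
  by (metis assms energy_soft_sqrt energy_strict_mono leD leI soft_sqrt_energy soft_sqrt_pos order_le_less)

lemma soft_sqrt_strict_mono:
  assumes "0 < k" "s < t"
  shows "soft_sqrt k s < soft_sqrt k t"
  using assms by (simp add: soft_sqrt_less_iff soft_sqrt_pos energy_soft_sqrt)

lemma soft_sqrt_mono:
  assumes "0 < k" "s \<le> t"
  shows "soft_sqrt k s \<le> soft_sqrt k t"
  using assms by (simp add: soft_sqrt_le_iff soft_sqrt_pos energy_soft_sqrt)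

text \<open>Inverse function rule for \<open>energy k\<close>: the reciprocal of
  \<open>x + 1 / (k * x)\<close>, expanded by \<open>x\<close> so that the factor later called
  \<open>w\<close> becomes visible.\<close>

lemma DERIV_soft_sqrt:
  assumes k: "0 < k"
  shows "(soft_sqrt k has_real_derivative
           soft_sqrt k s / ((soft_sqrt k s)\<^sup>2 + 1 / real k)) (at s)"
proof -
  define x where "x = soft_sqrt k s"
  have x: "0 < x" "energy k x = s"
    using k by (auto simp: x_def soft_sqrt_pos energy_soft_sqrt)
  have "(soft_sqrt k has_real_derivative inverse (x + 1 / (real k * x))) (at (energy k x))"
  proof (rule has_field_derivative_inverse_strong[where f = "energy k" and S = "{0<..}"])
    show "x + 1 / (real k * x) \<noteq> 0"
      using k x by (simp add: add_pos_pos less_imp_neq[symmetric])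
  qed (use k x in \<open>auto simp: DERIV_energy continuous_on_energy soft_sqrt_energy\<close>)
  also have "inverse (x + 1 / (real k * x)) = x / (x\<^sup>2 + 1 / real k)"
  proof -
    have "x * x * real k + 1 > 0"
      using x by (simp add: add_nonneg_pos)
    then show ?thesis
      using k x by (simp add: field_simps power2_eq_square)
  qed
  finally show ?thesis
    by (simp add: x x_def[symmetric])
qed

lemma continuous_on_soft_sqrt:
  assumes "0 < k" "continuous_on S h"
  shows "continuous_on S (\<lambda>x. soft_sqrt k (h x))"
proof -
  have "continuous_on UNIV (soft_sqrt k)"
    by (meson DERIV_soft_sqrt DERIV_isCont assms(1) continuous_at_imp_continuous_on)
  then show ?thesis
    using assms(2) continuous_on_compose2 by blast
qed

text \<open>The energy of the right-hand side is \<open>s + e\<close> plus a logarithm over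
  \<open>k\<close>, and \<open>ke\<close> keeps that term above \<open>- e\<close>. Since the
  logarithm is smallest at \<open>s = 0\<close>, one condition on \<open>k\<close> covers all
  \<open>s \<ge> 0\<close>.\<close>

lemma soft_sqrt_upper:
  assumes k: "0 < k" and s: "0 \<le> s" and e: "0 < e" and ke: "- ln (2 * e) / 2 \<le> real k * e"
  shows "soft_sqrt k s \<le> sqrt (2 * (s + e))"
proof -
  have "ln (2 * e) / 2 \<le> ln (2 * (s + e)) / 2"
    using s e by simp
  then have "- e * real k \<le> ln (2 * (s + e)) / 2"
    using ke by (simp add: algebra_simps)
  then have "- e \<le> ln (2 * (s + e)) / 2 / real k"
    using k by (subst pos_le_divide_eq) auto
  then show ?thesis
    using k s e by (subst soft_sqrt_le_iff) (auto simp: energy_def ln_sqrt algebra_simps add_divide_distrib)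
qed

text \<open>Capping at \<open>1\<close> makes the logarithm nonpositive, so the energy of the
  left-hand side is at most \<open>s\<close> for every \<open>k\<close>.\<close>

lemma soft_sqrt_lower:
  assumes k: "0 < k" and s: "0 < s" "s \<le> t"
  shows "min 1 (sqrt (2 * s)) \<le> soft_sqrt k t"
proof -
  define x where "x = min 1 (sqrt (2 * s))"
  have x: "0 < x" "x \<le> 1" "x \<le> sqrt (2 * s)"
    using s by (auto simp: x_def)
  have "x\<^sup>2 \<le> (sqrt (2 * s))\<^sup>2"
    using x by (intro power_mono) auto
  moreover have "ln x / real k \<le> 0"
    using x by (simp add: divide_nonpos_nonneg)
  ultimately have "energy k x \<le> t"
    using s by (simp add: energy_def)
  then have "\<not> soft_sqrt k t < x"
    using k x by (simp add: soft_sqrt_less_iff)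
  then show ?thesis
    unfolding x_def by linarith
qed

text \<open>Subtracting the two energy identities leaves half the difference of squares and a
  difference of logarithms. The latter is bounded by the difference of squares through
  \<open>ln z \<le> z - 1\<close> and \<open>1 / k \<le> 1\<close>, which makes the constant
  independent of \<open>k\<close>.\<close>

lemma soft_sqrt_square_gap:
  assumes k: "0 < k" and st: "s \<le> t" and l: "0 < l" "l \<le> soft_sqrt k s"
  shows "(t - s) * (2 * l\<^sup>2 / (1 + l\<^sup>2)) \<le> (soft_sqrt k t)\<^sup>2 - (soft_sqrt k s)\<^sup>2"
proof -
  define x where "x = soft_sqrt k s"
  define y where "y = soft_sqrt k t"
  have xy: "0 < x" "x \<le> y" "l \<le> x"
    using assms by (auto simp: x_def y_def soft_sqrt_pos soft_sqrt_mono)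
  have ts: "t - s = (y\<^sup>2 - x\<^sup>2) / 2 + (ln y - ln x) / real k"
    using energy_soft_sqrt[OF k, of s] energy_soft_sqrt[OF k, of t]
    by (simp add: energy_def x_def y_def algebra_simps diff_divide_distrib)
  have d: "0 \<le> y\<^sup>2 - x\<^sup>2"
    using xy power_mono[of x y 2] by simp
  have "ln (y\<^sup>2 / x\<^sup>2) \<le> y\<^sup>2 / x\<^sup>2 - 1"
    using xy by (intro ln_le_minus_one) auto
  also have "\<dots> = (y\<^sup>2 - x\<^sup>2) / x\<^sup>2"
    using xy by (simp add: field_simps)
  also have "\<dots> \<le> (y\<^sup>2 - x\<^sup>2) / l\<^sup>2"
    using xy l d by (intro divide_left_mono power_mono) auto
  finally have "2 * (ln y - ln x) \<le> (y\<^sup>2 - x\<^sup>2) / l\<^sup>2"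
    using xy by (simp add: ln_div ln_realpow algebra_simps)
  moreover have "(ln y - ln x) / real k \<le> ln y - ln x"
    using k xy by (simp add: divide_le_eq mult_le_cancel_left1)
  ultimately have "t - s \<le> (y\<^sup>2 - x\<^sup>2) / 2 + ((y\<^sup>2 - x\<^sup>2) / l\<^sup>2) * (1 / 2)"
    using ts by argo
  also have "\<dots> = (y\<^sup>2 - x\<^sup>2) * ((1 + l\<^sup>2) / (2 * l\<^sup>2))"
    using l by (simp add: field_simps)
  finally have "t - s \<le> (y\<^sup>2 - x\<^sup>2) * ((1 + l\<^sup>2) / (2 * l\<^sup>2))" .
  moreover have "0 < 1 + l\<^sup>2"
    by (simp add: add_pos_nonneg)
  ultimately show ?thesis
    using l by (simp add: field_simps x_def y_def)
qed

section \<open>Averages over the circle\<close>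

lemma integral_pos_Icc:
  fixes h :: "real \<Rightarrow> real"
  assumes "continuous_on {a..b} h" "a < b" "\<And>x. x \<in> {a..b} \<Longrightarrow> 0 < h x"
  shows "0 < integral {a..b} h"
  using integral_less[of a b "\<lambda>_. 0" h] assms by (auto simp: cbox_interval box_real)

lemma interval_integral_continuous:
  fixes h :: "real \<Rightarrow> real"
  assumes "continuous_on {a..b} h" "a \<le> b"
  shows "(LBINT x=ereal a..ereal b. h x) = integral {a..b} h"
  using assms by (intro interval_integral_eq_integral borel_integrable_atLeastAtMost') auto

lemma exists_period_representative:
  obtains y where "0 \<le> y" "y < 2 * pi" "\<And>g. (\<And>x. g (x + 2 * pi) = g x) \<Longrightarrow> g y = (g x :: real)"
proof -
  define n where "n = \<lfloor>x / (2 * pi)\<rfloor>"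
  define y where "y = x - 2 * pi * real_of_int n"
  have "real_of_int n \<le> x / (2 * pi)" "x / (2 * pi) < real_of_int n + 1"
    unfolding n_def by linarith+
  then have "0 \<le> y" "y < 2 * pi"
    by (auto simp: y_def field_simps)
  moreover have "g y = g x" if g: "\<And>x. g (x + 2 * pi) = g x" for g :: "real \<Rightarrow> real"
  proof -
    have nat: "g (z + 2 * pi * real j) = g z" for z j
    proof (induction j)
      case (Suc j)
      have "g (z + 2 * pi * real (Suc j)) = g ((z + 2 * pi * real j) + 2 * pi)"
        by (simp add: algebra_simps)
      then show ?case
        using Suc g by simp
    qed simp
    show ?thesis
    \<comment> \<open>The induction covers natural multiples of the period, so for negative
      \<open>n\<close> the shift starts at \<open>x\<close> instead of \<open>y\<close>.\<close>
    proof (cases "0 \<le> n")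
      case True
      then show ?thesis
        using nat[of y "nat n"] by (simp add: y_def)
    next
      case False
      then show ?thesis
        using nat[of x "nat (- n)"] by (simp add: y_def)
    qed
  qed
  ultimately show ?thesis
    using that by blast
qed

section \<open>The roots for a periodic potential and their averages as functions of the level
  \<open>c\<close>\<close>

locale circle_potential =
  fixes f :: "real \<Rightarrow> real"
  assumes continuous_f: "continuous_on UNIV f"
    and periodic_f: "f (x + 2 * pi) = f x"
begin

lemma range_f: "range f = f ` {0..2 * pi}"
proof -
  have "f x \<in> f ` {0..2 * pi}" for x
  proof -
    obtain y where "0 \<le> y" "y < 2 * pi" "f y = f x"
      using exists_period_representative[of x] periodic_f by metis
    then show ?thesis
      by (intro image_eqI[of _ _ y]) auto
  qed
  then show ?thesis by auto
qed

lemma compact_range_f: "compact (range f)"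
  unfolding range_f
  by (intro compact_continuous_image continuous_on_subset[OF continuous_f]) auto

definition fmax :: real where "fmax = (SUP x. f x)"
definition fmin :: real where "fmin = (INF x. f x)"

lemma f_le_fmax: "f x \<le> fmax"
  unfolding fmax_def
  by (intro cSUP_upper bounded_imp_bdd_above compact_imp_bounded compact_range_f) auto

lemma fmin_le_f: "fmin \<le> f x"
  unfolding fmin_def
  by (intro cINF_lower bounded_imp_bdd_below compact_imp_bounded compact_range_f) auto

lemma fmin_attained: obtains x where "0 \<le> x" "x \<le> 2 * pi" "f x = fmin"
proof -
  obtain x where x: "x \<in> {0..2 * pi}" "\<And>y. y \<in> {0..2 * pi} \<Longrightarrow> f x \<le> f y"
    using continuous_attains_inf[of "{0..2 * pi}" f] continuous_on_subset[OF continuous_f] by auto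
  have "f x \<le> f y" for y
    using x(2) range_f by (metis imageE rangeI)
  then have "f x \<le> fmin"
    unfolding fmin_def by (intro cINF_greatest) auto
  with fmin_le_f[of x] x show ?thesis
    by (intro that[of x]) auto
qed

abbreviation G :: "nat \<Rightarrow> real \<Rightarrow> real \<Rightarrow> real" where
  "G \<equiv> gamma f"

text \<open>By implicit differentiation of \<open>energy k (G k c x) = c - f x\<close>, the derivative of
  \<open>G k c x\<close> in \<open>c\<close> is \<open>G k c x * w k c x\<close>.\<close>

definition w :: "nat \<Rightarrow> real \<Rightarrow> real \<Rightarrow> real" where
  "w k c x = 1 / ((G k c x)\<^sup>2 + 1 / real k)"

definition totalG :: "nat \<Rightarrow> real \<Rightarrow> real" where
  "totalG k c = integral {0..2 * pi} (G k c)"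

definition A :: "nat \<Rightarrow> real \<Rightarrow> real" where
  "A k c = integral {0..2 * pi} (\<lambda>x. 1 / G k c x)"

definition B :: "nat \<Rightarrow> real \<Rightarrow> real" where
  "B k c = integral {0..2 * pi} (\<lambda>x. G k c x * w k c x)"

definition D :: "nat \<Rightarrow> real \<Rightarrow> real" where
  "D k c = integral {0..2 * pi} (\<lambda>x. w k c x / G k c x)"

context
  fixes k :: nat
  assumes k: "0 < k"
begin

lemma G_pos: "0 < G k c x"
  using k by (simp add: gamma_eq_soft_sqrt soft_sqrt_pos)

lemma G_nonzero: "G k c x \<noteq> 0"
  using G_pos[of c x] by simp

lemma w_pos: "0 < w k c x"
  using k by (simp add: w_def add_nonneg_pos)

lemma w_le: "w k c x \<le> real k"
proof -
  have "w k c x \<le> 1 / (1 / real k)"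
    unfolding w_def using k by (intro divide_left_mono) (auto simp: add_nonneg_pos)
  then show ?thesis by simp
qed

text \<open>The source of the factor \<open>1 / k\<close> in both gradients: the leading
  \<open>1\<close> cancels against the derivative of \<open>Hbar1\<close> or of \<open>f\<close>,
  and only the term with \<open>w / k\<close> survives.\<close>

lemma G_square_w: "(G k c x)\<^sup>2 * w k c x = 1 - w k c x / real k"
proof -
  have "(G k c x)\<^sup>2 + 1 / real k > 0"
    using k by (simp add: add_nonneg_pos)
  then show ?thesis
    using k unfolding w_def by (simp add: divide_simps)
qed

lemma G_strict_mono: "c < d \<Longrightarrow> G k c x < G k d x"
  using k by (simp add: gamma_eq_soft_sqrt soft_sqrt_strict_mono)

lemma continuous_on_G [continuous_intros]:
  assumes "continuous_on S p" "continuous_on S q"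
  shows "continuous_on S (\<lambda>x. G k (p x) (q x))"
  unfolding gamma_eq_soft_sqrt
  by (intro continuous_on_soft_sqrt k continuous_intros assms continuous_on_compose2[OF continuous_f]) auto

lemma continuous_on_w [continuous_intros]:
  assumes "continuous_on S p" "continuous_on S q"
  shows "continuous_on S (\<lambda>x. w k (p x) (q x))"
proof -
  have "0 < (G k c x)\<^sup>2 + 1 / real k" for c x
    using k by (simp add: add_nonneg_pos)
  then show ?thesis
    unfolding w_def by (intro continuous_intros assms) (metis less_irrefl)
qed

lemma DERIV_G: "((\<lambda>c. G k c x) has_real_derivative (G k c x * w k c x)) (at c)"
proof -
  have "((\<lambda>c. soft_sqrt k (c - f x)) has_real_derivative
          soft_sqrt k (c - f x) / ((soft_sqrt k (c - f x))\<^sup>2 + 1 / real k) * 1) (at c)"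
    by (rule DERIV_chain2[OF DERIV_soft_sqrt[OF k]]) (auto intro!: derivative_eq_intros)
  then show ?thesis
    by (simp add: gamma_eq_soft_sqrt w_def)
qed

lemma DERIV_totalG: "(totalG k has_real_derivative B k c) (at c)"
proof -
  have "((\<lambda>c. integral (cbox 0 (2 * pi)) (G k c)) has_real_derivative
         integral (cbox 0 (2 * pi)) (\<lambda>x. G k c x * w k c x)) (at c within UNIV)"
    by (rule leibniz_rule_field_derivative)
      (auto simp: case_prod_unfold intro!: DERIV_G integrable_continuous_interval continuous_intros)
  then show ?thesis
    by (simp add: totalG_def [abs_def] B_def)
qed

lemma DERIV_A: "(A k has_real_derivative - D k c) (at c)"
proof -
  have d: "((\<lambda>c. 1 / G k c x) has_real_derivative - (w k c x / G k c x)) (at c)" for c x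
    using DERIV_divide[OF DERIV_const[of 1] DERIV_G[where c = c and x = x] G_nonzero]
      G_nonzero[of c x]
    by simp
  have "((\<lambda>c. integral (cbox 0 (2 * pi)) (\<lambda>x. 1 / G k c x)) has_real_derivative
         integral (cbox 0 (2 * pi)) (\<lambda>x. - (w k c x / G k c x))) (at c within UNIV)"
    by (rule leibniz_rule_field_derivative)
      (auto simp: case_prod_unfold G_nonzero
        intro!: d integrable_continuous_interval continuous_intros)
  then show ?thesis
    by (simp add: A_def [abs_def] D_def)
qed

lemma A_pos: "0 < A k c" and B_pos: "0 < B k c" and D_pos: "0 < D k c"
  unfolding A_def B_def D_def
  by (intro integral_pos_Icc continuous_intros; simp add: G_pos w_pos G_nonzero)+

lemma continuous_on_BD:
  "continuous_on UNIV (B k)" "continuous_on UNIV (D k)"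
  unfolding B_def [abs_def] D_def [abs_def]
  by (subst cbox_interval [symmetric], rule integral_continuous_on_param,
      auto simp: case_prod_unfold G_nonzero intro!: continuous_intros)+

text \<open>This is \<open>G_square_w\<close> divided by \<open>G\<close> and integrated over the
  circle.\<close>

lemma B_eq: "B k c = A k c - D k c / real k"
proof -
  have eq: "G k c x * w k c x = 1 / G k c x - (w k c x / G k c x) / real k" for x
    using G_square_w[of c x] G_nonzero[of c x] by (simp add: field_simps power2_eq_square)
  have "(\<lambda>x. 1 / G k c x) integrable_on {0..2 * pi}"
    "(\<lambda>x. w k c x / G k c x) integrable_on {0..2 * pi}"
    by (auto simp: G_nonzero intro!: integrable_continuous_interval continuous_intros)
  then show ?thesis
    unfolding A_def B_def D_def eq
    by (subst integral_diff) (auto intro: integrable_on_divide simp del: divide_divide_eq_left)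
qed

lemma totalG_strict_mono:
  assumes "c < d" shows "totalG k c < totalG k d"
  unfolding totalG_def cbox_interval [symmetric]
  by (rule integral_less) (auto intro!: continuous_intros simp: box_real G_strict_mono assms not_le)

lemma c_approx_eq: "c_approx f k J = (THE c. 2 * pi * J = totalG k c)"
proof -
  have "(LBINT x=ereal 0..ereal (2 * pi). G k c x) = totalG k c" for c
    unfolding totalG_def by (intro interval_integral_continuous continuous_intros) auto
  then show ?thesis
    unfolding c_approx_def by (auto simp: field_simps)
qed

lemma c_approx_totalG: "c_approx f k (totalG k c / (2 * pi)) = c"
  unfolding c_approx_eq
  by (rule the_equality) (auto, metis less_irrefl linorder_less_linear totalG_strict_mono)

lemma totalG_ge:
  assumes "\<And>x. l \<le> G k c x"
  shows "2 * pi * l \<le> totalG k c"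
proof -
  have "integral {0..2 * pi} (\<lambda>_. l) \<le> totalG k c"
    unfolding totalG_def
    by (intro integral_le integrable_continuous_interval continuous_intros assms)
  then show ?thesis by simp
qed

lemma totalG_le:
  assumes "\<And>x. G k c x \<le> u"
  shows "totalG k c \<le> 2 * pi * u"
proof -
  have "totalG k c \<le> integral {0..2 * pi} (\<lambda>_. u)"
    unfolding totalG_def
    by (intro integral_le integrable_continuous_interval continuous_intros assms)
  then show ?thesis by simp
qed

text \<open>At the level \<open>energy k J + fmin\<close> the root is at most \<open>J\<close>
  everywhere, at \<open>energy k J + fmax\<close> it is at least \<open>J\<close> everywhere. The
  intermediate value theorem gives a level in between, hence also the bound from above.\<close>

lemma totalG_c_approx:
  assumes J: "0 < J"
  shows "totalG k (c_approx f k J) = 2 * pi * J"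
    and "c_approx f k J \<le> energy k J + fmax"
proof -
  define a where "a = energy k J + fmin"
  define b where "b = energy k J + fmax"
  have "G k a x \<le> J" "J \<le> G k b x" for x
    using soft_sqrt_mono[OF k, of "a - f x" "energy k J"]
      soft_sqrt_mono[OF k, of "energy k J" "b - f x"] fmin_le_f[of x] f_le_fmax[of x]
    by (auto simp: a_def b_def gamma_eq_soft_sqrt soft_sqrt_energy[OF k J])
  then have ab: "totalG k a \<le> 2 * pi * J" "2 * pi * J \<le> totalG k b"
    by (auto intro: totalG_le totalG_ge)
  have "a \<le> b"
    using fmin_le_f[of 0] f_le_fmax[of 0] by (simp add: a_def b_def)
  moreover have "continuous_on {a..b} (totalG k)"
    by (meson DERIV_totalG DERIV_isCont continuous_at_imp_continuous_on)
  ultimately obtain c where c: "c \<le> b" "totalG k c = 2 * pi * J"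
    using IVT'[of "totalG k" a "2 * pi * J" b] ab by auto
  then have "c_approx f k J = c"
    using c_approx_totalG[of c] by simp
  with c show "totalG k (c_approx f k J) = 2 * pi * J" "c_approx f k J \<le> energy k J + fmax"
    by (auto simp: b_def)
qed

lemma DERIV_c_approx:
  assumes J: "0 < J"
  shows "(c_approx f k has_real_derivative (2 * pi / B k (c_approx f k J))) (at J)"
proof -
  let ?h = "\<lambda>c. totalG k c / (2 * pi)"
  define c where "c = c_approx f k J"
  have cont: "continuous_on UNIV (totalG k)"
    by (meson DERIV_totalG DERIV_isCont continuous_at_imp_continuous_on)
  have "(c_approx f k has_real_derivative inverse (B k c / (2 * pi))) (at (?h c))"
    by (rule has_field_derivative_inverse_strong[where f = ?h and S = UNIV])
      (use B_pos[of c] in \<open>auto simp: c_approx_totalG intro!: DERIV_cdivide DERIV_totalG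
         continuous_intros cont\<close>)
  then show ?thesis
    using totalG_c_approx(1)[OF J] by (simp add: c_def)
qed

end

end

section \<open>The variance of \<open>w\<close> and the harmonic mean of the roots\<close>

lemma inverse_tangent_line:
  fixes x a :: real
  assumes "0 < x" "0 < a"
  shows "2 / a - 1 / a\<^sup>2 * x \<le> 1 / x"
proof -
  have "1 / x - (2 / a - 1 / a\<^sup>2 * x) = (1 - x / a)\<^sup>2 / x"
    using assms by (simp add: power2_diff diff_divide_distrib add_divide_distrib power_divide) (simp add: power2_eq_square)
  also have "\<dots> \<ge> 0" using assms by simp
  finally show ?thesis by simp
qed

context circle_potential
begin

context
  fixes k :: nat
  assumes k: "0 < k"
begin

lemma has_integral_A: "((\<lambda>x. 1 / G k c x) has_integral A k c) {0..2 * pi}"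
  unfolding A_def
  by (auto intro!: integrable_integral integrable_continuous_interval continuous_intros continuous_on_G k
      simp: G_nonzero[OF k])

lemma has_integral_D: "((\<lambda>x. w k c x / G k c x) has_integral D k c) {0..2 * pi}"
  unfolding D_def
  by (auto intro!: integrable_integral integrable_continuous_interval continuous_intros
      continuous_on_G continuous_on_w k simp: G_nonzero[OF k])

lemma has_integral_totalG: "(G k c has_integral totalG k c) {0..2 * pi}"
  unfolding totalG_def
  by (auto intro!: integrable_integral integrable_continuous_interval continuous_intros continuous_on_G k)

lemma A_nonzero: "A k c \<noteq> 0" and B_nonzero: "B k c \<noteq> 0"
  using A_pos[OF k, of c] B_pos[OF k, of c] by auto

text \<open>Expanding the variance and using \<open>w \<le> k\<close> once in the second moment; the factor \<open>B\<close>
  appears through \<open>B = A - D / k\<close>.\<close>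

lemma variance_upper:
  "integral {0..2 * pi} (\<lambda>x. (w k c x - D k c / A k c)\<^sup>2 * ((1 / G k c x) / A k c))
     \<le> real k * D k c * B k c / (A k c)\<^sup>2"
proof -
  define \<mu> where "\<mu> = D k c / A k c"
  note pos = G_pos[OF k, of c] w_pos[OF k, of c] A_pos[OF k, of c]
  note [continuous_intros] = continuous_on_G[OF k] continuous_on_w[OF k]
  have ne: "G k c x \<noteq> 0" for x
    using G_nonzero[OF k] .
  have "integral {0..2 * pi} (\<lambda>x. (w k c x - \<mu>)\<^sup>2 * ((1 / G k c x) / A k c))
      \<le> integral {0..2 * pi} (\<lambda>x. (real k - 2 * \<mu>) / A k c * (w k c x / G k c x)
            + \<mu>\<^sup>2 / A k c * (1 / G k c x))"
  proof (rule integral_le)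
    fix x
    have "(w k c x)\<^sup>2 \<le> real k * w k c x"
      using w_le[OF k, of c x] pos(2)[of x] by (simp add: power2_eq_square)
    then have "(w k c x - \<mu>)\<^sup>2 \<le> (real k - 2 * \<mu>) * w k c x + \<mu>\<^sup>2"
      by (simp add: power2_eq_square algebra_simps)
    then have "(w k c x - \<mu>)\<^sup>2 * ((1 / G k c x) / A k c)
        \<le> ((real k - 2 * \<mu>) * w k c x + \<mu>\<^sup>2) * ((1 / G k c x) / A k c)"
      using pos(1)[of x] pos(3) by (intro mult_right_mono) auto
    then show "(w k c x - \<mu>)\<^sup>2 * ((1 / G k c x) / A k c)
        \<le> (real k - 2 * \<mu>) / A k c * (w k c x / G k c x) + \<mu>\<^sup>2 / A k c * (1 / G k c x)"
      by (simp add: add_divide_distrib distrib_right mult.commute)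
  qed (auto intro!: integrable_continuous_interval continuous_intros simp: ne A_nonzero)
  also have "\<dots> = (real k - 2 * \<mu>) / A k c * D k c + \<mu>\<^sup>2 / A k c * A k c"
    by (intro integral_unique has_integral_add has_integral_mult_right has_integral_A has_integral_D)
  also have "\<dots> = real k * D k c * B k c / (A k c)\<^sup>2"
    using pos(3) k by (simp add: \<mu>_def B_eq[OF k] field_simps power2_eq_square)
  finally show ?thesis
    by (simp add: \<mu>_def)
qed

end

text \<open>The harmonic mean over the circle of the root with arithmetic mean
  \<open>J\<close>.\<close>

definition rate :: "nat \<Rightarrow> real \<Rightarrow> real" where
  "rate k J = 2 * pi / A k (c_approx f k J)"

text \<open>The derivative of \<open>rate\<close>, obtained from \<open>dA / dc = - D\<close> and
  \<open>dc / dJ = 2 * pi / B\<close>. In this form it is also what \<open>variance_upper\<close>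
  yields after rescaling.\<close>

definition rate' :: "nat \<Rightarrow> real \<Rightarrow> real" where
  "rate' k J = (2 * pi)\<^sup>2 * D k (c_approx f k J)
     / (B k (c_approx f k J) * (A k (c_approx f k J))\<^sup>2)"

context
  fixes k :: nat
  assumes k: "0 < k"
begin

lemma rate_pos: "0 < rate k J"
  unfolding rate_def by (simp add: A_pos[OF k])

lemma rate'_nonneg: "0 \<le> rate' k J"
  unfolding rate'_def using A_pos[OF k] B_pos[OF k] D_pos[OF k]
  by (intro divide_nonneg_nonneg mult_nonneg_nonneg) (auto intro: less_imp_le)

text \<open>The inequality between harmonic and arithmetic mean: the tangent of \<open>1 / x\<close>
  at \<open>J\<close> lies below the graph, and the arithmetic mean of the root is
  \<open>J\<close>.\<close>

lemma rate_le:
  assumes J: "0 < J"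
  shows "rate k J \<le> J"
proof -
  define c where "c = c_approx f k J"
  have "2 / J * (2 * pi) - 1 / J\<^sup>2 * totalG k c \<le> A k c"
  proof (rule has_integral_le)
    show "((\<lambda>x. 2 / J * 1 - 1 / J\<^sup>2 * G k c x) has_integral
      (2 / J * (2 * pi) - 1 / J\<^sup>2 * totalG k c)) {0..2 * pi}"
      using has_integral_const_real[of "1 :: real" 0 "2 * pi"]
      by (intro has_integral_diff has_integral_mult_right has_integral_totalG k) simp_all
    show "((\<lambda>x. 1 / G k c x) has_integral A k c) {0..2 * pi}"
      by (rule has_integral_A[OF k])
    fix x
    show "2 / J * 1 - 1 / J\<^sup>2 * G k c x \<le> 1 / G k c x"
      using inverse_tangent_line[OF G_pos[OF k] J] by simp
  qed
  moreover have "totalG k c = 2 * pi * J"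
    using totalG_c_approx(1)[OF k J] by (simp add: c_def)
  ultimately have "2 * pi / J \<le> A k c"
    using J by (simp add: field_simps power2_eq_square)
  then show ?thesis
    using J A_pos[OF k, of c] by (simp add: rate_def c_def[symmetric] field_simps)
qed

lemma DERIV_rate:
  assumes J: "0 < J"
  shows "(rate k has_real_derivative rate' k J) (at J)"
proof -
  define c where "c = c_approx f k J"
  have "((\<lambda>J. A k (c_approx f k J)) has_real_derivative - D k c * (2 * pi / B k c)) (at J)"
    unfolding c_def by (rule DERIV_chain2[OF DERIV_A[OF k] DERIV_c_approx[OF k J]])
  from DERIV_divide[OF DERIV_const[of "2 * pi"] this]
  have "(rate k has_real_derivative
      (0 * A k c - 2 * pi * (- D k c * (2 * pi / B k c))) / (A k c * A k c)) (at J)"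
    unfolding rate_def [abs_def] c_def using A_nonzero[OF k] by blast
  also have "(0 * A k c - 2 * pi * (- D k c * (2 * pi / B k c))) / (A k c * A k c) = rate' k J"
    unfolding rate'_def c_def[symmetric] by (simp add: power2_eq_square)
  finally show ?thesis .
qed

lemma continuous_on_rate': "continuous_on {0<..} (rate' k)"
proof -
  have c: "continuous_on {0<..} (c_approx f k)"
    by (meson DERIV_c_approx DERIV_isCont k continuous_at_imp_continuous_on greaterThan_iff)
  have A: "continuous_on UNIV (A k)"
    by (meson DERIV_A DERIV_isCont k continuous_at_imp_continuous_on)
  note cc = continuous_on_compose2[OF A c] continuous_on_compose2[OF continuous_on_BD(1)[OF k] c]
    continuous_on_compose2[OF continuous_on_BD(2)[OF k] c]
  show ?thesis
    unfolding rate'_def [abs_def]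
    by (intro continuous_on_divide continuous_on_mult continuous_on_power continuous_on_const cc)
      (simp_all add: A_nonzero[OF k] B_nonzero[OF k])
qed

text \<open>The odd extension of \<open>rate\<close> is continuous at \<open>0\<close> because \<open>0 < rate J \<le> J\<close>.\<close>

lemma rate'_has_integral:
  assumes R: "0 < R"
  shows "((\<lambda>J. rate' k \<bar>J\<bar>) has_integral 2 * rate k R) {- R..R}"
proof -
  define H where "H J = sgn J * rate k \<bar>J\<bar>" for J
  have d: "(H has_real_derivative rate' k \<bar>J\<bar>) (at J)" if "J \<noteq> 0" for J
  proof (cases "0 < J")
    case True
    show ?thesis
      by (rule has_field_derivative_transform_within_open[where f = "rate k" and S = "{0<..}"])
        (use True DERIV_rate[of J] in \<open>auto simp: H_def\<close>)
  next
    case False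
    with that have neg: "J < 0" by simp
    have "((\<lambda>J. - rate k (- J)) has_real_derivative - (rate' k (- J) * (- 1))) (at J)"
      by (rule DERIV_minus, rule DERIV_chain2[OF DERIV_rate])
        (use neg in \<open>auto intro!: derivative_eq_intros\<close>)
    then show ?thesis
      by (rule has_field_derivative_transform_within_open[where f = "\<lambda>J. - rate k (- J)" and S = "{..<0}", THEN DERIV_cong])
        (use neg in \<open>auto simp: H_def\<close>)
  qed
  have "isCont H J" for J
  proof (cases "J = 0")
    case True
    have "norm (H J) \<le> norm J" for J
      using rate_pos[of "\<bar>J\<bar>"] rate_le[of "\<bar>J\<bar>"]
      by (cases "J = 0") (auto simp: H_def abs_mult abs_sgn_eq)
    moreover have "((\<lambda>J::real. norm J) \<longlongrightarrow> 0) (at 0)"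
      using tendsto_norm_zero[OF tendsto_ident_at] .
    ultimately have "(H \<longlongrightarrow> 0) (at 0)"
      by (intro Lim_null_comparison[of H "\<lambda>J. norm J"] always_eventually) auto
    then show ?thesis
      using True by (simp add: isCont_def H_def)
  qed (use d DERIV_isCont in blast)
  then have "continuous_on {- R..R} H"
    by (simp add: continuous_at_imp_continuous_on)
  then have "((\<lambda>J. rate' k \<bar>J\<bar>) has_integral H R - H (- R)) {- R..R}"
    using d R by (intro fundamental_theorem_of_calculus_interior_strong[of "{0}"])
      (auto simp flip: has_real_derivative_iff_has_vector_derivative)
  then show ?thesis
    using R by (simp add: H_def)
qed

end

section \<open>The limiting energy and uniform bounds on the roots\<close>

text \<open>Without the case distinction, continuity across the set where \<open>f x = c\<close> is
  evident.\<close>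

lemma gamma0_eq: "gamma0 f c x = sqrt (max 0 (2 * (c - f x)))"
  by (auto simp: gamma0_def max_def)

definition total0 :: "real \<Rightarrow> real" where
  "total0 c = integral {0..2 * pi} (gamma0 f c)"

lemma continuous_on_gamma0 [continuous_intros]:
  assumes "continuous_on S p" "continuous_on S q"
  shows "continuous_on S (\<lambda>x. gamma0 f (p x) (q x))"
  unfolding gamma0_eq
  by (intro continuous_intros assms continuous_on_compose2[OF continuous_f]) auto

lemma continuous_on_total0: "continuous_on S total0"
proof -
  have "continuous_on UNIV total0"
    unfolding total0_def [abs_def] cbox_interval [symmetric]
    by (rule integral_continuous_on_param) (auto simp: case_prod_unfold intro!: continuous_intros)
  then show ?thesis
    using continuous_on_subset by blast
qed

text \<open>The difference of the two integrands is continuous, nonnegative and positive at a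
  minimum point of \<open>f\<close>. The bound \<open>fmin < d\<close> is essential, as
  \<open>total0\<close> vanishes up to \<open>fmin\<close>.\<close>

lemma total0_strict_mono:
  assumes "c < d" "fmin < d"
  shows "total0 c < total0 d"
proof -
  let ?h = "\<lambda>x. gamma0 f d x - gamma0 f c x"
  obtain x where x: "0 \<le> x" "x \<le> 2 * pi" "f x = fmin"
    by (rule fmin_attained)
  have nonneg: "0 \<le> ?h y" for y
    using assms by (simp add: gamma0_eq)
  have "0 < ?h x"
    using assms x by (simp add: gamma0_eq max_def)
  then have "integral {0..2 * pi} ?h \<noteq> 0"
    using integral_eq_0_iff[of 0 "2 * pi" ?h] nonneg x
    by (force intro!: continuous_intros)
  moreover have "0 \<le> integral {0..2 * pi} ?h"
    by (intro integral_nonneg integrable_continuous_interval continuous_intros nonneg)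
  moreover have "integral {0..2 * pi} ?h = total0 d - total0 c"
    unfolding total0_def
    by (intro integral_diff integrable_continuous_interval continuous_intros)
  ultimately show ?thesis by simp
qed

lemma total0_eq_0: "c \<le> fmin \<Longrightarrow> total0 c = 0"
  unfolding total0_def gamma0_eq using fmin_le_f
  by (intro integral_unique has_integral_is_0) (metis diff_le_0_iff_le max.absorb1 mult_le_0_iff
      order_trans real_sqrt_zero zero_le_numeral)

text \<open>A positive mean forces the level above \<open>fmin\<close>, where \<open>total0\<close>
  is injective.\<close>

lemma c_limit_eqI:
  assumes "0 < J" "total0 c = 2 * pi * J"
  shows "c_limit f J = c"
proof -
  have eq: "(LBINT x=ereal 0..ereal (2 * pi). gamma0 f c x) = total0 c" for c
    unfolding total0_def by (intro interval_integral_continuous continuous_intros) auto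
  show ?thesis
    unfolding c_limit_def eq
  proof (rule the_equality)
    fix d
    assume "J = 1 / (2 * pi) * total0 d"
    then have d: "total0 d = 2 * pi * J" by simp
    then have "fmin < c" "fmin < d"
      using total0_eq_0[of c] total0_eq_0[of d] assms by (force simp: not_le[symmetric])+
    then show "d = c"
      using total0_strict_mono[of c d] total0_strict_mono[of d c] d assms by force
  qed (use assms in simp)
qed

lemma total0_c_limit:
  assumes J: "0 < J"
  shows "total0 (c_limit f J) = 2 * pi * J"
proof -
  \<comment> \<open>At this level \<open>gamma0\<close> is at least \<open>J\<close> everywhere,
    while at \<open>fmin\<close> its integral is zero; the intermediate value theorem applies
    between the two.\<close>
  define b where "b = fmax + J\<^sup>2 / 2"
  have "J \<le> gamma0 f b x" for x
  proof -
    have "J\<^sup>2 \<le> 2 * (b - f x)"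
      using f_le_fmax[of x] by (simp add: b_def)
    then have "J\<^sup>2 \<le> max 0 (2 * (b - f x))"
      by simp
    then show ?thesis
      unfolding gamma0_eq by (rule real_le_rsqrt)
  qed
  then have "integral {0..2 * pi} (\<lambda>_. J) \<le> total0 b"
    unfolding total0_def
    by (intro integral_le integrable_continuous_interval continuous_intros)
  then have "2 * pi * J \<le> total0 b"
    by simp
  moreover have "fmin \<le> b"
    using fmin_le_f[of 0] f_le_fmax[of 0] zero_le_power2[of J] unfolding b_def by linarith
  ultimately obtain c where "total0 c = 2 * pi * J"
    using IVT'[of total0 fmin "2 * pi * J" b] J continuous_on_total0
    by (auto simp: total0_eq_0)
  then show ?thesis
    using c_limit_eqI[OF J] by simp
qed

text \<open>For large \<open>k\<close> the regularised root lies below \<open>sqrt (2 * (s + e))\<close>, so a level \<open>c'\<close>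
  slightly below \<open>c\<close> has mean at most \<open>total0 c / (2 * pi)\<close>.\<close>

lemma c_approx_lower:
  assumes c': "fmax < c'" "c' < c" and k: "0 < k"
    and ke: "- ln (2 * (c - c')) / 2 \<le> real k * (c - c')"
    and J: "0 < J" "total0 c \<le> 2 * pi * J"
  shows "c' \<le> c_approx f k J"
proof (rule ccontr)
  assume "\<not> c' \<le> c_approx f k J"
  then have "2 * pi * J < totalG k c'"
    using totalG_strict_mono[OF k, of "c_approx f k J" c'] totalG_c_approx(1)[OF k J(1)] by simp
  also have "totalG k c' \<le> total0 c"
    unfolding totalG_def total0_def
  proof (intro integral_le integrable_continuous_interval continuous_intros continuous_on_G k)
    fix x
    have "soft_sqrt k (c' - f x) \<le> sqrt (2 * (c' - f x + (c - c')))"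
      using c' k ke f_le_fmax[of x] by (intro soft_sqrt_upper) auto
    also have "\<dots> = gamma0 f c x"
      using c' f_le_fmax[of x] by (simp add: gamma0_def)
    finally show "G k c' x \<le> gamma0 f c x"
      by (simp add: gamma_eq_soft_sqrt)
  qed
  finally show False
    using J by simp
qed

lemma G_uniform_bounds:
  assumes c: "fmax < c" and J: "0 < J" "total0 c \<le> 2 * pi * J" and R: "J \<le> R"
  obtains l L where "0 < l" "1 \<le> L"
    "\<forall>\<^sub>F k in sequentially. 0 < k \<and>
       (\<forall>J'\<in>{J..R}. \<forall>x. l \<le> G k (c_approx f k J') x \<and> G k (c_approx f k J') x \<le> L)"
proof -
  \<comment> \<open>Half of the room above \<open>fmax\<close> is spent on passing from
    \<open>total0\<close> to the regularised mean; the other half keeps \<open>c' - f x\<close>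
    positive.\<close>
  define c' where "c' = (fmax + c) / 2"
  have c': "fmax < c'" "c' < c"
    using c by (auto simp: c'_def field_simps)
  define l where "l = min 1 (sqrt (2 * (c' - fmax)))"
  \<comment> \<open>This bounds \<open>c_approx f k J' - f x\<close> for all momenta up to
    \<open>R\<close>, since \<open>ln R / k \<le> \<bar>ln R\<bar>\<close>. Then \<open>L\<close> is
    \<open>soft_sqrt_upper\<close> with \<open>e = 1\<close>.\<close>
  define s where "s = R\<^sup>2 / 2 + \<bar>ln R\<bar> + (fmax - fmin)"
  define L where "L = sqrt (2 * (s + 1))"
  have s: "0 \<le> s"
    using fmin_le_f[of 0] f_le_fmax[of 0] by (simp add: s_def)
  have "0 < l"
    using c' by (simp add: l_def)
  moreover have "1 \<le> L"
    using s by (simp add: L_def)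
  moreover have "\<forall>\<^sub>F k in sequentially. 0 < k \<and>
      - ln (2 * (c - c')) / 2 \<le> real k * (c - c')"
  proof -
    obtain N :: nat where N: "- ln (2 * (c - c')) / 2 / (c - c') \<le> real N"
      using real_arch_simple by blast
    show ?thesis
    proof (rule eventually_sequentiallyI[of "Suc N"])
      fix k assume "Suc N \<le> k"
      then have "- ln (2 * (c - c')) / 2 / (c - c') \<le> real k"
        using N by linarith
      then have "- ln (2 * (c - c')) / 2 \<le> real k * (c - c')"
        using c' by (subst (asm) pos_divide_le_eq) auto
      with \<open>Suc N \<le> k\<close> show "0 < k \<and> - ln (2 * (c - c')) / 2 \<le> real k * (c - c')"
        by simp
    qed
  qed
  then have "\<forall>\<^sub>F k in sequentially. 0 < k \<and>
       (\<forall>J'\<in>{J..R}. \<forall>x. l \<le> G k (c_approx f k J') x \<and> G k (c_approx f k J') x \<le> L)"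
  proof (rule eventually_mono, intro conjI ballI allI)
    fix k
    assume k': "0 < k \<and> - ln (2 * (c - c')) / 2 \<le> real k * (c - c')"
    then show k: "0 < k" by simp
    fix J' x
    assume J': "J' \<in> {J..R}"
    define cJ where "cJ = c_approx f k J'"
    have "2 * pi * J \<le> 2 * pi * J'"
      using J' by simp
    then have "total0 c \<le> 2 * pi * J'"
      using J by linarith
    then have "c' \<le> cJ"
      unfolding cJ_def using c' k' J J' by (intro c_approx_lower) auto
    then show "l \<le> G k (c_approx f k J') x"
      unfolding gamma_eq_soft_sqrt l_def cJ_def[symmetric] using c' f_le_fmax[of x]
      by (intro soft_sqrt_lower k) auto
    have "energy k J' \<le> energy k R"
      using J J' energy_strict_mono[OF k, of J' R] by (cases "J' = R") auto
    also have "energy k R \<le> R\<^sup>2 / 2 + \<bar>ln R\<bar>"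
    proof -
      have "ln R / real k \<le> \<bar>ln R\<bar> / real k"
        by (intro divide_right_mono) auto
      also have "\<dots> \<le> \<bar>ln R\<bar> / 1"
        using k by (intro divide_left_mono) auto
      finally show ?thesis by (simp add: energy_def)
    qed
    finally have "cJ - f x \<le> s"
      using totalG_c_approx(2)[OF k, of J'] J J' fmin_le_f[of x] by (auto simp: s_def cJ_def)
    then have "soft_sqrt k (cJ - f x) \<le> soft_sqrt k s"
      by (intro soft_sqrt_mono k)
    also have "- ln 2 \<le> real k * 2"
      by (smt (verit) ln_gt_zero of_nat_0_le_iff)
    then have "soft_sqrt k s \<le> L"
      unfolding L_def using soft_sqrt_upper[OF k s, of 1] by simp
    finally show "G k (c_approx f k J') x \<le> L"
      by (simp add: gamma_eq_soft_sqrt cJ_def)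
  qed
  ultimately show ?thesis
    by (rule that)
qed

end

section \<open>The one-dimensional integrals\<close>

lemma continuous_less_on_Icc:
  fixes h :: "real \<Rightarrow> real"
  assumes "continuous_on UNIV h" "h x < a" "u \<le> x" "x \<le> v" "u < v"
  obtains p q where "u \<le> p" "p < q" "q \<le> v" "\<And>y. y \<in> {p..q} \<Longrightarrow> h y < a"
proof -
  have "open {y. h y < a}"
    using assms(1) by (intro open_Collect_less) auto
  then obtain e where e: "0 < e" "\<And>y. dist y x < e \<Longrightarrow> h y < a"
    using assms(2) unfolding open_dist by force
  \<comment> \<open>The halved radius keeps the closed interval inside the open ball; the
    intersection with \<open>{u..v}\<close> has positive length even if \<open>x\<close> is an
    endpoint.\<close>
  show ?thesis
  proof (rule that[of "max u (x - e / 2)" "min v (x + e / 2)"])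
    show "max u (x - e / 2) < min v (x + e / 2)"
      using assms e by auto
    show "h y < a" if "y \<in> {max u (x - e / 2)..min v (x + e / 2)}" for y
      using that e by (auto simp: dist_real_def)
  qed auto
qed

context circle_potential
begin

text \<open>The integrand of \<open>E1\<close> in terms of the level and the first angle, as
  \<open>E1_integrand\<close> shows; \<open>dens2\<close> plays the same role for
  \<open>E2\<close>.\<close>

definition dens1 :: "nat \<Rightarrow> real \<Rightarrow> real \<Rightarrow> real" where
  "dens1 k c x = (1 / real k * (2 * pi / B k c) * (w k c x - D k c / A k c))\<^sup>2 * ((1 / G k c x) / A k c)"

definition dens2 :: "(real \<Rightarrow> real) \<Rightarrow> nat \<Rightarrow> real \<Rightarrow> real \<Rightarrow> real" where
  "dens2 f' k c x = (1 / real k * f' x * w k c x)\<^sup>2 * ((1 / G k c x) / A k c)"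

lemma dens_nonneg:
  assumes k: "0 < k"
  shows "0 \<le> dens1 k c x" "0 \<le> dens2 f' k c x"
  using A_pos[OF k, of c] G_pos[OF k, of c x] by (auto simp: dens1_def dens2_def)

lemma continuous_on_dens1:
  assumes k: "0 < k"
  shows "continuous_on S (dens1 k c)"
  unfolding dens1_def [abs_def]
  by (intro continuous_intros continuous_on_G continuous_on_w k) (auto simp: G_nonzero k A_nonzero)

lemma continuous_on_dens2:
  assumes k: "0 < k" and "continuous_on S f'"
  shows "continuous_on S (dens2 f' k c)"
  unfolding dens2_def [abs_def]
  by (intro continuous_intros continuous_on_G continuous_on_w k assms) (auto simp: G_nonzero k A_nonzero)

text \<open>The square of \<open>2 * pi / (k * B)\<close> turns the variance bound into an exact
  derivative in \<open>J\<close> over \<open>k\<close>. Momenta near the critical level are thus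
  controlled after integration in \<open>J\<close>.\<close>

lemma dens1_upper:
  assumes k: "0 < k"
  shows "integral {0..2 * pi} (dens1 k (c_approx f k J)) \<le> rate' k J / real k"
proof -
  define c where "c = c_approx f k J"
  have pos: "0 < A k c" "0 < B k c"
    using A_pos B_pos k by auto
  have "integral {0..2 * pi} (dens1 k c) = (1 / real k * (2 * pi / B k c))\<^sup>2 *
      integral {0..2 * pi} (\<lambda>x. (w k c x - D k c / A k c)\<^sup>2 * ((1 / G k c x) / A k c))"
    unfolding dens1_def [abs_def] power_mult_distrib mult.assoc by (simp only: integral_mult_right)
  also have "\<dots> \<le> (1 / real k * (2 * pi / B k c))\<^sup>2 * (real k * D k c * B k c / (A k c)\<^sup>2)"
    by (intro mult_left_mono variance_upper k) auto
  also have "\<dots> = rate' k J / real k"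
    using k pos by (simp add: rate'_def c_def[symmetric] field_simps power2_eq_square)
  finally show ?thesis by (simp add: c_def)
qed

section \<open>Estimates at a level where the root stays between \<open>l\<close> and
  \<open>L\<close>\<close>

context
  fixes k :: nat and c l L :: real
  assumes k: "0 < k" and l: "0 < l" and L: "1 \<le> L"
    and bounds: "\<And>x. l \<le> G k c x" "\<And>x. G k c x \<le> L"
begin

lemma w_bounds: "1 / (L\<^sup>2 + 1) \<le> w k c x" "w k c x \<le> 1 / l\<^sup>2"
proof -
  have le: "l\<^sup>2 \<le> (G k c x)\<^sup>2" "(G k c x)\<^sup>2 \<le> L\<^sup>2"
    using bounds[of x] l by (auto intro!: power_mono)
  have "1 / real k \<le> 1"
    using k by simp
  then have "(G k c x)\<^sup>2 + 1 / real k \<le> L\<^sup>2 + 1"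
    using le by linarith
  then show "1 / (L\<^sup>2 + 1) \<le> w k c x"
    unfolding w_def using k by (intro divide_left_mono mult_pos_pos add_nonneg_pos) auto
  have "0 < 1 / real k"
    using k by simp
  with le have "l\<^sup>2 \<le> (G k c x)\<^sup>2 + 1 / real k"
    by linarith
  then show "w k c x \<le> 1 / l\<^sup>2"
    unfolding w_def using k l by (intro divide_left_mono mult_pos_pos add_nonneg_pos) auto
qed

lemma A_le: "A k c \<le> 2 * pi / l"
proof -
  have "A k c \<le> 1 / l * (2 * pi)"
  proof (rule has_integral_le[OF has_integral_A[OF k]])
    show "((\<lambda>_. 1 / l) has_integral 1 / l * (2 * pi)) {0..2 * pi}"
      using has_integral_const_real[of "1 / l" 0 "2 * pi"] by (simp add: mult.commute)
    show "1 / G k c x \<le> 1 / l" for x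
      using bounds(1)[of x] l by (intro divide_left_mono) auto
  qed
  then show ?thesis by simp
qed

lemma sigma_lower: "l / (2 * pi * L) \<le> (1 / G k c x) / A k c"
proof -
  have G: "0 < G k c x"
    using G_pos[OF k] .
  have "l / (2 * pi * L) = (1 / L) / (2 * pi / l)"
    using l by simp
  also have "\<dots> \<le> (1 / G k c x) / A k c"
    using A_le A_pos[OF k, of c] bounds[of x] G l L
    by (intro frac_le divide_left_mono) (auto intro: mult_pos_pos)
  finally show ?thesis .
qed

lemma B_le: "B k c \<le> 2 * pi / l"
proof -
  have "0 \<le> D k c / real k"
    using D_pos[OF k, of c] by simp
  then show ?thesis
    using A_le B_eq[OF k, of c] by simp
qed

text \<open>A higher potential means a smaller root and a larger \<open>w\<close>. The difference of
  the two reciprocals is the gap of the squared roots times both values of \<open>w\<close>, and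
  each factor is bounded below.\<close>

lemma w_gap:
  assumes "f x + d \<le> f y" "0 \<le> d"
  shows "d * (2 * l\<^sup>2 / (1 + l\<^sup>2)) / (L\<^sup>2 + 1)\<^sup>2 \<le> w k c y - w k c x"
proof -
  define g where "g = (G k c x)\<^sup>2 - (G k c y)\<^sup>2"
  have "d * (2 * l\<^sup>2 / (1 + l\<^sup>2)) \<le> (f y - f x) * (2 * l\<^sup>2 / (1 + l\<^sup>2))"
    using assms by (intro mult_right_mono divide_nonneg_nonneg) (auto intro: add_nonneg_nonneg)
  also have "\<dots> \<le> g"
    using soft_sqrt_square_gap[OF k, of "c - f y" "c - f x" l] l bounds(1)[of y] assms
    by (simp add: g_def gamma_eq_soft_sqrt)
  finally have g: "d * (2 * l\<^sup>2 / (1 + l\<^sup>2)) \<le> g" .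
  have "0 \<le> d * (2 * l\<^sup>2 / (1 + l\<^sup>2))"
    using assms by (intro mult_nonneg_nonneg divide_nonneg_nonneg) (auto intro: add_nonneg_nonneg)
  then have "d * (2 * l\<^sup>2 / (1 + l\<^sup>2)) * (1 / (L\<^sup>2 + 1) * (1 / (L\<^sup>2 + 1))) \<le> g * (w k c x * w k c y)"
    using g w_bounds(1)[of x] w_bounds(1)[of y]
    by (intro mult_mono) (auto intro!: add_nonneg_nonneg order_trans[OF _ w_bounds(1)])
  also have "g * (w k c x * w k c y) = w k c y - w k c x"
  proof -
    define r s where "r = (G k c x)\<^sup>2 + 1 / real k" and "s = (G k c y)\<^sup>2 + 1 / real k"
    have "0 < r" "0 < s"
      using k by (auto simp: r_def s_def intro: add_nonneg_pos)
    moreover have "g = r - s"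
      by (simp add: g_def r_def s_def)
    ultimately show ?thesis
      unfolding w_def r_def[symmetric] s_def[symmetric] by (simp add: field_simps)
  qed
  finally show ?thesis
    by (simp add: power2_eq_square)
qed

text \<open>The integral is restricted to \<open>{p..q}\<close>, where \<open>2 * pi / B\<close> is
  at least \<open>l\<close>, the distance of \<open>w\<close> from its mean at least
  \<open>e\<close>, and the density \<open>\<sigma>\<close> at least
  \<open>l / (2 * pi * L)\<close>.\<close>

lemma integral_dens1_lower:
  assumes p: "0 \<le> p" "p \<le> q" "q \<le> 2 * pi" and e: "0 \<le> e"
    and far: "\<And>x. x \<in> {p..q} \<Longrightarrow> e \<le> \<bar>w k c x - D k c / A k c\<bar>"
  shows "(l * e)\<^sup>2 * (l / (2 * pi * L)) * (q - p) / (real k)\<^sup>2 \<le> integral {0..2 * pi} (dens1 k c)"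
proof -
  have "(l * e)\<^sup>2 * (l / (2 * pi * L)) * (q - p) / (real k)\<^sup>2
      = integral {p..q} (\<lambda>_. (1 / real k * l * e)\<^sup>2 * (l / (2 * pi * L)))"
    using p by (simp add: power_mult_distrib power_divide mult_ac)
  also have "\<dots> \<le> integral {p..q} (dens1 k c)"
  proof (intro integral_le integrable_continuous_interval continuous_intros continuous_on_dens1 k)
    fix x assume x: "x \<in> {p..q}"
    have "l \<le> 2 * pi / B k c"
      using B_le B_pos[OF k, of c] l by (simp add: field_simps)
    then have "1 / real k * l * e \<le> 1 / real k * (2 * pi / B k c) * \<bar>w k c x - D k c / A k c\<bar>"
      using far[OF x] e l B_pos[OF k, of c] by (intro mult_mono mult_left_mono) auto
    then have "(1 / real k * l * e)\<^sup>2
        \<le> (1 / real k * (2 * pi / B k c) * \<bar>w k c x - D k c / A k c\<bar>)\<^sup>2"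
      using e l by (intro power_mono) auto
    also have "\<dots> = (1 / real k * (2 * pi / B k c) * (w k c x - D k c / A k c))\<^sup>2"
      by (simp only: power_mult_distrib power2_abs)
    finally show "(1 / real k * l * e)\<^sup>2 * (l / (2 * pi * L)) \<le> dens1 k c x"
      unfolding dens1_def using l L by (intro mult_mono sigma_lower) auto
  qed
  also have "\<dots> \<le> integral {0..2 * pi} (dens1 k c)"
    using p dens_nonneg(1)[OF k]
    by (intro integral_subset_le integrable_continuous_interval continuous_on_dens1 k) auto
  finally show ?thesis .
qed

lemma dens2_bounds:
  assumes f': "continuous_on UNIV f'" and M: "\<And>x. x \<in> {0..2 * pi} \<Longrightarrow> \<bar>f' x\<bar> \<le> M"
  shows "(1 / (L\<^sup>2 + 1))\<^sup>2 * (l / (2 * pi * L)) * integral {0..2 * pi} (\<lambda>x. (f' x)\<^sup>2) / (real k)\<^sup>2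
           \<le> integral {0..2 * pi} (dens2 f' k c)" (is ?lower)
    and "integral {0..2 * pi} (dens2 f' k c) \<le> (M / l\<^sup>2)\<^sup>2 / (real k)\<^sup>2" (is ?upper)
proof -
  have f'_on: "continuous_on S f'" for S
    using f' continuous_on_subset by blast
  have "(1 / (L\<^sup>2 + 1))\<^sup>2 * (l / (2 * pi * L)) * integral {0..2 * pi} (\<lambda>x. (f' x)\<^sup>2) / (real k)\<^sup>2
    = (1 / real k)\<^sup>2 * (1 / (L\<^sup>2 + 1))\<^sup>2 * (l / (2 * pi * L)) * integral {0..2 * pi} (\<lambda>x. (f' x)\<^sup>2)"
    by (simp add: power_divide)
  also have "\<dots> = integral {0..2 * pi}
      (\<lambda>x. (1 / real k)\<^sup>2 * (1 / (L\<^sup>2 + 1))\<^sup>2 * (l / (2 * pi * L)) * (f' x)\<^sup>2)"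
    by (simp only: integral_mult_right)
  also have "\<dots> \<le> integral {0..2 * pi} (dens2 f' k c)"
  proof (intro integral_le integrable_continuous_interval continuous_intros continuous_on_dens2 k f'_on)
    fix x
    have "0 \<le> 1 / (L\<^sup>2 + 1)"
      by (intro divide_nonneg_nonneg add_nonneg_nonneg) auto
    then have "(1 / (L\<^sup>2 + 1))\<^sup>2 \<le> (w k c x)\<^sup>2"
      by (intro power_mono w_bounds)
    then have "(1 / (L\<^sup>2 + 1))\<^sup>2 * (l / (2 * pi * L)) \<le> (w k c x)\<^sup>2 * ((1 / G k c x) / A k c)"
      using l L by (intro mult_mono sigma_lower) auto
    then have "(1 / real k * f' x)\<^sup>2 * ((1 / (L\<^sup>2 + 1))\<^sup>2 * (l / (2 * pi * L)))
      \<le> (1 / real k * f' x)\<^sup>2 * ((w k c x)\<^sup>2 * ((1 / G k c x) / A k c))"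
      by (rule mult_left_mono) simp
    then show "(1 / real k)\<^sup>2 * (1 / (L\<^sup>2 + 1))\<^sup>2 * (l / (2 * pi * L)) * (f' x)\<^sup>2 \<le> dens2 f' k c x"
      by (simp only: dens2_def power_mult_distrib mult_ac)
  qed
  finally show ?lower .
  \<comment> \<open>The density \<open>\<sigma>\<close> has total mass one; its mass appears here as
    the quotient of \<open>A\<close> by itself.\<close>
  have "integral {0..2 * pi} (dens2 f' k c) \<le> (1 / real k * M * (1 / l\<^sup>2))\<^sup>2 / A k c * A k c"
  proof (rule has_integral_le)
    show "(dens2 f' k c has_integral integral {0..2 * pi} (dens2 f' k c)) {0..2 * pi}"
      by (intro integrable_integral integrable_continuous_interval continuous_on_dens2 k f'_on)
    show "((\<lambda>x. (1 / real k * M * (1 / l\<^sup>2))\<^sup>2 / A k c * (1 / G k c x)) has_integral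
        (1 / real k * M * (1 / l\<^sup>2))\<^sup>2 / A k c * A k c) {0..2 * pi}"
      by (intro has_integral_mult_right has_integral_A k)
    fix x assume x: "x \<in> {0..2 * pi}"
    have "\<bar>1 / real k * f' x * w k c x\<bar> \<le> 1 / real k * M * (1 / l\<^sup>2)"
    proof -
      have "0 \<le> M" "0 \<le> w k c x"
        using M[OF x] w_pos[OF k, of c x] by auto
      then have "1 / real k * \<bar>f' x\<bar> * w k c x \<le> 1 / real k * M * (1 / l\<^sup>2)"
        using M[OF x] w_bounds(2)[of x] by (intro mult_mono mult_left_mono) auto
      with \<open>0 \<le> w k c x\<close> show ?thesis
        by (simp add: abs_mult)
    qed
    then have "(1 / real k * f' x * w k c x)\<^sup>2 \<le> (1 / real k * M * (1 / l\<^sup>2))\<^sup>2"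
      by (metis abs_ge_zero power2_abs power_mono)
    then have "dens2 f' k c x \<le> (1 / real k * M * (1 / l\<^sup>2))\<^sup>2 * ((1 / G k c x) / A k c)"
      unfolding dens2_def using A_pos[OF k, of c] G_pos[OF k, of c x] by (intro mult_right_mono) auto
    then show "dens2 f' k c x \<le> (1 / real k * M * (1 / l\<^sup>2))\<^sup>2 / A k c * (1 / G k c x)"
      by (simp add: mult.commute)
  qed
  also have "\<dots> = (M / l\<^sup>2)\<^sup>2 / (real k)\<^sup>2"
    using A_nonzero[OF k, of c] by (simp add: power_mult_distrib power_divide)
  finally show ?upper .
qed

end

text \<open>Near a low point and near a high point of \<open>f\<close> the values of
  \<open>w\<close> differ by at least \<open>2 * e\<close>. So the mean of \<open>w\<close> cannot
  come within \<open>e\<close> of \<open>w\<close> on both intervals, and one of them lies entirely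
  at distance \<open>e\<close> from it.\<close>

lemma dens1_lower:
  assumes nonconst: "\<not> f constant_on UNIV" and l: "0 < l" and L: "1 \<le> L"
  obtains \<kappa> where "0 < \<kappa>"
    "\<And>k c. 0 < k \<Longrightarrow> (\<And>x. l \<le> G k c x \<and> G k c x \<le> L) \<Longrightarrow>
       \<kappa> / (real k)\<^sup>2 \<le> integral {0..2 * pi} (dens1 k c)"
proof -
  obtain x1 x2 where x: "x1 \<in> {0..2 * pi}" "x2 \<in> {0..2 * pi}" "f x1 < f x2"
  proof -
    obtain a b where "f a \<noteq> f b"
      using nonconst unfolding constant_on_def by metis
    moreover obtain a' where a': "a' \<in> {0..2 * pi}" "f a = f a'"
      using range_f by (metis imageE rangeI)
    moreover obtain b' where b': "b' \<in> {0..2 * pi}" "f b = f b'"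
      using range_f by (metis imageE rangeI)
    ultimately consider "f a' < f b'" | "f b' < f a'"
      by linarith
    then show thesis
      by cases (auto intro: that a' b')
  qed
  \<comment> \<open>A loss of \<open>d\<close> at each of the two points leaves a gap of
    \<open>d\<close> between the intervals.\<close>
  define d where "d = (f x2 - f x1) / 3"
  have d: "0 < d"
    using x by (simp add: d_def)
  obtain p q where p: "0 \<le> p" "p < q" "q \<le> 2 * pi"
    and fp: "\<And>y. y \<in> {p..q} \<Longrightarrow> f y < f x1 + d"
    using continuous_less_on_Icc[OF continuous_f, of x1 "f x1 + d" 0 "2 * pi"] x d by auto
  obtain p' q' where p': "0 \<le> p'" "p' < q'" "q' \<le> 2 * pi"
    and fp': "\<And>y. y \<in> {p'..q'} \<Longrightarrow> - f y < - f x2 + d"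
    using continuous_less_on_Icc[OF continuous_on_minus[OF continuous_f], of x2 "- f x2 + d" 0 "2 * pi"] x d
    by auto
  define e where "e = d * (2 * l\<^sup>2 / (1 + l\<^sup>2)) / (L\<^sup>2 + 1)\<^sup>2 / 2"
  have e: "0 < e"
    unfolding e_def using d l
    by (intro divide_pos_pos mult_pos_pos zero_less_power add_pos_nonneg add_nonneg_pos) auto
  \<comment> \<open>Which interval is far from the mean may change with \<open>k\<close> and
    \<open>c\<close>, so the constant uses the shorter length.\<close>
  define r where "r = min (q - p) (q' - p')"
  define \<kappa> where "\<kappa> = (l * e)\<^sup>2 * (l / (2 * pi * L)) * r"
  have "0 < \<kappa>"
    using l L e p p' by (auto simp: \<kappa>_def r_def intro!: mult_pos_pos divide_pos_pos)
  moreover have "\<kappa> / (real k)\<^sup>2 \<le> integral {0..2 * pi} (dens1 k c)"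
    if k: "0 < k" and bd: "\<And>x. l \<le> G k c x \<and> G k c x \<le> L" for k c
  proof -
    define \<mu> where "\<mu> = D k c / A k c"
    have gap: "2 * e \<le> w k c y - w k c x" if "x \<in> {p..q}" "y \<in> {p'..q'}" for x y
    proof -
      have "3 * d = f x2 - f x1"
        by (simp add: d_def)
      then have "f x + d \<le> f y"
        using fp[OF that(1)] fp'[OF that(2)] by linarith
      then show ?thesis
        using w_gap[OF k l L, of c x d y] bd d by (simp add: e_def mult_ac)
    qed
    have "(\<forall>x\<in>{p..q}. e \<le> \<bar>w k c x - \<mu>\<bar>) \<or> (\<forall>x\<in>{p'..q'}. e \<le> \<bar>w k c x - \<mu>\<bar>)"
    proof (rule ccontr)
      assume "\<not> ?thesis"
      then obtain x y where "x \<in> {p..q}" "\<bar>w k c x - \<mu>\<bar> < e" "y \<in> {p'..q'}" "\<bar>w k c y - \<mu>\<bar> < e"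
        by (auto simp: not_le)
      with gap[of x y] show False
        by linarith
    qed
    then obtain a b where ab: "0 \<le> a" "a \<le> b" "b \<le> 2 * pi" "r \<le> b - a"
      "\<And>x. x \<in> {a..b} \<Longrightarrow> e \<le> \<bar>w k c x - \<mu>\<bar>"
    proof
      assume "\<forall>x\<in>{p..q}. e \<le> \<bar>w k c x - \<mu>\<bar>"
      then show thesis
        using p by (intro that[of p q]) (auto simp: r_def)
    next
      assume "\<forall>x\<in>{p'..q'}. e \<le> \<bar>w k c x - \<mu>\<bar>"
      then show thesis
        using p' by (intro that[of p' q']) (auto simp: r_def)
    qed
    have "\<kappa> / (real k)\<^sup>2 \<le> (l * e)\<^sup>2 * (l / (2 * pi * L)) * (b - a) / (real k)\<^sup>2"
      unfolding \<kappa>_def using ab l L by (intro divide_right_mono mult_left_mono) auto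
    also have "\<dots> \<le> integral {0..2 * pi} (dens1 k c)"
      using ab e bd by (intro integral_dens1_lower k l L) (auto simp: \<mu>_def)
    finally show ?thesis .
  qed
  ultimately show ?thesis
    by (rule that)
qed

end

section \<open>Reduction to one coordinate\<close>

text \<open>Agreement near \<open>x\<close> is enough, which matters because the formulas for
  \<open>u_n\<close> hold only off the hyperplane of vanishing first momentum. Uniqueness of the
  derivative resolves the description in \<open>grad\<close>.\<close>

lemma grad_coordinate:
  fixes F :: "real ^ 'n::finite \<Rightarrow> real"
  assumes h: "(h has_real_derivative d) (at (x $ i))"
    and F: "\<forall>\<^sub>F y in nhds x. F y = h (y $ i)"
  shows "grad F x = d *\<^sub>R axis i 1"
proof -
  have "GDERIV (\<lambda>y. y $ i) x :> axis i (1 :: real)"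
    unfolding gderiv_def inner_axis
    by (simp add: bounded_linear_imp_has_derivative bounded_linear_vec_nth)
  then have "GDERIV (\<lambda>y. h (y $ i)) x :> d *\<^sub>R axis i 1"
    by (rule GDERIV_DERIV_compose) (rule h)
  then have "(F has_derivative (\<lambda>y. inner y (d *\<^sub>R axis i 1))) (at x)"
    unfolding gderiv_def
    by (rule has_derivative_transform_eventually)
      (use F eventually_nhds_x_imp_x[OF F] in \<open>auto simp: eventually_at_filter elim: eventually_mono\<close>)
  then have G: "GDERIV F x :> d *\<^sub>R axis i 1"
    by (simp only: gderiv_def)
  show ?thesis
    unfolding grad_def
  proof (rule the_equality)
    fix E assume "GDERIV F x :> E"
    with G have "(\<lambda>y. inner y E) = (\<lambda>y. inner y (d *\<^sub>R axis i 1))"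
      unfolding gderiv_def by (rule has_derivative_unique[rotated])
    then show "E = d *\<^sub>R axis i 1"
      by (metis vector_eq_ldot)
  qed (rule G)
qed

lemma nn_integral_coordinate_box:
  fixes h :: "real \<Rightarrow> real" and i :: "'n::finite"
  assumes h [measurable]: "h \<in> borel_measurable borel" and nonneg: "\<And>t. 0 \<le> h t" and ab: "a \<le> b"
  shows "(\<integral>\<^sup>+x. ennreal (h (x $ i)) * indicator {x :: real ^ 'n. \<forall>j. j \<noteq> i \<longrightarrow> x $ j \<in> {a..b}} x \<partial>lborel)
    = ennreal ((b - a) ^ (CARD('n) - 1)) * (\<integral>\<^sup>+t. ennreal (h t) \<partial>lborel)"
proof -
  define e :: "'n \<Rightarrow> real ^ 'n" where "e j = axis j 1" for j
  have basis: "Basis = range e" and inj: "inj e"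
    by (auto simp: Basis_vec_def e_def axis_eq_axis inj_on_def)
  have inner_e: "x \<bullet> e j = x $ j" for x j
    by (simp add: e_def inner_axis)
  \<comment> \<open>One factor per basis vector: the integral over the space then splits as a
    product over \<open>Basis\<close>.\<close>
  define g where "g v = (if v = e i then h else indicator {a..b})" for v
  have [measurable]: "g v \<in> borel_measurable borel" for v
    by (simp add: g_def)
  have g_nonneg: "0 \<le> g v t" for v t
    by (simp add: g_def nonneg)
  have split: "(\<Prod>j\<in>UNIV. p j) = p i * (\<Prod>j\<in>UNIV - {i}. p j)" for p :: "'n \<Rightarrow> 'c::comm_monoid_mult"
    by (simp add: prod.remove[of _ i])
  have g_e: "g (e i) = h" "j \<noteq> i \<Longrightarrow> g (e j) = indicator {a..b}" for j
    using inj by (auto simp: g_def inj_eq)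
  have "(\<integral>\<^sup>+x. ennreal (h (x $ i)) * indicator {x :: real ^ 'n. \<forall>j. j \<noteq> i \<longrightarrow> x $ j \<in> {a..b}} x \<partial>lborel)
      = (\<integral>\<^sup>+x. ennreal (\<Prod>v\<in>Basis. g v (x \<bullet> v)) \<partial>lborel)"
  proof (rule nn_integral_cong)
    fix x :: "real ^ 'n"
    have "(\<Prod>v\<in>Basis. g v (x \<bullet> v)) = h (x $ i) * (\<Prod>j\<in>UNIV - {i}. indicator {a..b} (x $ j))"
      unfolding basis by (simp add: prod.reindex[OF inj] inner_e split g_e)
    also have "(\<Prod>j\<in>UNIV - {i}. indicator {a..b} (x $ j))
        = (indicator {x. \<forall>j. j \<noteq> i \<longrightarrow> x $ j \<in> {a..b}} x :: real)"
      by (auto simp: indicator_def intro!: prod.neutral prod_zero)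
    finally have eq: "(\<Prod>v\<in>Basis. g v (x \<bullet> v))
        = h (x $ i) * indicator {x. \<forall>j. j \<noteq> i \<longrightarrow> x $ j \<in> {a..b}} x" .
    show "ennreal (h (x $ i)) * indicator {x. \<forall>j. j \<noteq> i \<longrightarrow> x $ j \<in> {a..b}} x
        = ennreal (\<Prod>v\<in>Basis. g v (x \<bullet> v))"
      unfolding eq by (simp add: ennreal_mult nonneg ennreal_indicator)
  qed
  also have "\<dots> = (\<Prod>v\<in>Basis. \<integral>\<^sup>+t. ennreal (g v t) \<partial>lborel)"
    using nn_integral_lborel_prod[of "\<lambda>v t. ennreal (g v t)"] by (simp add: prod_ennreal g_nonneg)
  also have "\<dots> = (\<integral>\<^sup>+t. ennreal (h t) \<partial>lborel) * (\<Prod>j\<in>UNIV - {i}. \<integral>\<^sup>+t. ennreal (indicator {a..b} t) \<partial>lborel)"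
    unfolding basis by (simp add: prod.reindex[OF inj] split g_e)
  also have "(\<integral>\<^sup>+t. ennreal (indicator {a..b} t) \<partial>lborel) = ennreal (b - a)"
    using ab by (simp add: ennreal_indicator)
  also have "(\<Prod>j\<in>UNIV - {i}. ennreal (b - a)) = ennreal ((b - a) ^ (CARD('n) - 1))"
    using ab by (simp add: ennreal_power card_Diff_singleton)
  finally show ?thesis
    by (simp add: mult.commute)
qed

lemma nn_integral_torus_coordinate:
  fixes h :: "real \<Rightarrow> real" and i :: "'n::finite"
  assumes h: "continuous_on {0..2 * pi} h" and nonneg: "\<And>t. 0 \<le> h t"
  shows "(\<integral>\<^sup>+\<phi>\<in>(torus :: (real ^ 'n) set). ennreal (h (\<phi> $ i)) \<partial>lborel)
    = ennreal ((2 * pi) ^ (CARD('n) - 1) * integral {0..2 * pi} h)"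
proof -
  define p where "p t = indicator {0..2 * pi} t * h t" for t
  have p: "p \<in> borel_measurable borel" "\<And>t. 0 \<le> p t"
    using borel_measurable_continuous_on_indicator[OF _ h] nonneg by (auto simp: p_def [abs_def])
  have "(\<integral>\<^sup>+\<phi>\<in>(torus :: (real ^ 'n) set). ennreal (h (\<phi> $ i)) \<partial>lborel)
    = (\<integral>\<^sup>+x. ennreal (p (x $ i)) * indicator {x :: real ^ 'n. \<forall>j. j \<noteq> i \<longrightarrow> x $ j \<in> {0..2 * pi}} x \<partial>lborel)"
    by (intro nn_integral_cong) (auto simp: p_def torus_def indicator_def)
  also have "\<dots> = ennreal ((2 * pi) ^ (CARD('n) - 1)) * (\<integral>\<^sup>+t. ennreal (p t) \<partial>lborel)"
    using nn_integral_coordinate_box[OF p, of 0 "2 * pi" i] by simp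
  also have "(\<integral>\<^sup>+t. ennreal (p t) \<partial>lborel) = ennreal (integral {0..2 * pi} h)"
    unfolding p_def
    by (rule nn_integral_has_integral_lebesgue)
      (auto intro: nonneg integrable_integral integrable_continuous_interval h)
  also have "ennreal ((2 * pi) ^ (CARD('n) - 1)) * ennreal (integral {0..2 * pi} h)
      = ennreal ((2 * pi) ^ (CARD('n) - 1) * integral {0..2 * pi} h)"
    by (intro ennreal_mult [symmetric] integral_nonneg nonneg integrable_continuous_interval h) simp
  finally show ?thesis .
qed

text \<open>The integral is oriented, so \<open>x\<close> may have either sign; a symmetric interval
  with \<open>x\<close> in its interior gives the two-sided derivative.\<close>

lemma DERIV_interval_integral:
  fixes h :: "real \<Rightarrow> real"
  assumes "continuous_on UNIV h"
  shows "((\<lambda>u. LBINT y=ereal 0..ereal u. h y) has_real_derivative h x) (at x)"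
proof -
  define r where "r = \<bar>x\<bar> + 1"
  have "((\<lambda>u. LBINT y=ereal 0..ereal u. h y) has_vector_derivative h x) (at x within {- r..r})"
    by (rule interval_integral_FTC2) (auto simp: r_def intro: continuous_on_subset[OF assms])
  moreover have "at x within {- r..r} = at x"
    by (rule at_within_interior) (auto simp: r_def)
  ultimately show ?thesis
    by (simp add: has_real_derivative_iff_has_vector_derivative)
qed

section \<open>The gradients in \<open>E1\<close> and \<open>E2\<close> as functions of the first
  coordinates\<close>

context circle_potential
begin

context
  fixes k :: nat
  assumes k: "0 < k"
begin

lemma DERIV_u1:
  assumes J: "J \<noteq> 0"
  shows "(u1 f k J has_real_derivative sgn J * G k (c_approx f k \<bar>J\<bar>) x - J) (at x)"
proof -
  have pos: "(u1_pos f k \<bar>J\<bar> has_real_derivative G k (c_approx f k \<bar>J\<bar>) x - \<bar>J\<bar>) (at x)"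
    unfolding u1_pos_def [abs_def]
    by (auto intro!: derivative_eq_intros DERIV_interval_integral continuous_on_G k continuous_intros)
  show ?thesis
  proof (cases "J < 0")
    case True
    then show ?thesis
      using DERIV_minus[OF pos] by (simp add: u1_def [abs_def])
  next
    case False
    with J pos show ?thesis
      by (simp add: u1_def [abs_def])
  qed
qed

lemma grad_u_n:
  fixes I \<phi> :: "real ^ 'n::finite"
  assumes "I $ i \<noteq> 0"
  shows "grad (u_n f i k I) \<phi> = (sgn (I $ i) * G k (c_approx f k \<bar>I $ i\<bar>) (\<phi> $ i) - I $ i) *\<^sub>R axis i 1"
  by (rule grad_coordinate[OF DERIV_u1[OF assms]]) (simp add: u_n_def)

lemma norm_plus_grad_u_n:
  fixes I \<phi> :: "real ^ 'n::finite"
  assumes "I $ i \<noteq> 0"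
  shows "(norm (I + grad (u_n f i k I) \<phi>))\<^sup>2
    = (G k (c_approx f k \<bar>I $ i\<bar>) (\<phi> $ i))\<^sup>2 + (\<Sum>j\<in>UNIV - {i}. (I $ j)\<^sup>2)"
proof -
  let ?g = "G k (c_approx f k \<bar>I $ i\<bar>) (\<phi> $ i)"
  define v where "v = I + grad (u_n f i k I) \<phi>"
  have v: "v $ j = (if j = i then sgn (I $ i) * ?g else I $ j)" for j
    by (simp add: v_def grad_u_n[OF assms] axis_def)
  have "(norm v)\<^sup>2 = (\<Sum>j\<in>UNIV. (v $ j)\<^sup>2)"
    by (simp add: power2_norm_eq_inner inner_vec_def) (simp add: power2_eq_square)
  also have "\<dots> = (v $ i)\<^sup>2 + (\<Sum>j\<in>UNIV - {i}. (v $ j)\<^sup>2)"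
    by (simp add: sum.remove[of _ i])
  also have "\<dots> = ?g\<^sup>2 + (\<Sum>j\<in>UNIV - {i}. (I $ j)\<^sup>2)"
    using assms by (simp add: v power_mult_distrib sgn_if)
  finally show ?thesis
    by (simp add: v_def)
qed

lemma A_eq: "(LBINT x=ereal 0..ereal (2 * pi). 1 / G k c x) = A k c"
  unfolding A_def
  by (intro interval_integral_continuous continuous_intros continuous_on_G k) (auto simp: G_nonzero[OF k])

lemma sigma_n_eq:
  "sigma_n f i k I \<phi> = (1 / G k (c_approx f k \<bar>I $ i\<bar>) (\<phi> $ i)) / A k (c_approx f k \<bar>I $ i\<bar>)"
  by (simp only: sigma_n_def sigma1_def A_eq)

text \<open>In the variable \<open>c\<close> the derivative is
  \<open>G\<^sup>2 * w - 1 + D / (k * A)\<close>, where \<open>G_square_w\<close> removes the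
  constant; the chain rule contributes \<open>2 * pi / B\<close> and the sign of
  \<open>J\<close>.\<close>

lemma DERIV_residual:
  assumes J: "J \<noteq> 0"
  shows "((\<lambda>J. (G k (c_approx f k \<bar>J\<bar>) x)\<^sup>2 / 2 - Hbar1 f k J) has_real_derivative
    - (sgn J * (1 / real k * (2 * pi / B k (c_approx f k \<bar>J\<bar>))
        * (w k (c_approx f k \<bar>J\<bar>) x - D k (c_approx f k \<bar>J\<bar>) / A k (c_approx f k \<bar>J\<bar>))))) (at J)"
proof -
  define c where "c = c_approx f k \<bar>J\<bar>"
  define c' where "c' = 2 * pi / B k c"
  have A: "0 < A k c"
    by (rule A_pos[OF k])
  have "(abs has_real_derivative sgn J) (at J)"
    using GDERIV_norm[OF J] by (simp add: real_norm_def [abs_def])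
  then have "((\<lambda>J. c_approx f k \<bar>J\<bar>) has_real_derivative c' * sgn J) (at J)"
    unfolding c'_def c_def using J by (intro DERIV_chain2[OF DERIV_c_approx[OF k]]) auto
  moreover have "((\<lambda>c. (G k c x)\<^sup>2 / 2 - (c + 1 / real k * ln (A k c))) has_real_derivative
      (2 * G k c x * (G k c x * w k c x) / 2 - (1 + 1 / real k * (1 / A k c * - D k c)))) (at c)"
    using A k by (auto intro!: derivative_eq_intros DERIV_G[OF k] DERIV_A[OF k])
  ultimately have "((\<lambda>J. (G k (c_approx f k \<bar>J\<bar>) x)\<^sup>2 / 2
        - (c_approx f k \<bar>J\<bar> + 1 / real k * ln (A k (c_approx f k \<bar>J\<bar>)))) has_real_derivative
      (2 * G k c x * (G k c x * w k c x) / 2 - (1 + 1 / real k * (1 / A k c * - D k c))) * (c' * sgn J)) (at J)"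
    unfolding c_def by (rule DERIV_chain2[rotated])
  moreover have "(2 * G k c x * (G k c x * w k c x) / 2 - (1 + 1 / real k * (1 / A k c * - D k c))) * (c' * sgn J)
      = - (sgn J * (1 / real k * c' * (w k c x - D k c / A k c)))"
  proof -
    have "2 * G k c x * (G k c x * w k c x) / 2 = 1 - 1 / real k * w k c x"
      using G_square_w[OF k, of c x] by (simp add: power2_eq_square)
    moreover have "1 / A k c * - D k c = - (D k c / A k c)"
      by simp
    moreover have "(1 - a * v - (1 + a * - d)) * (b * s) = - (s * (a * b * (v - d)))" for a v d b s :: real
      by (simp add: algebra_simps)
    ultimately show ?thesis
      by (simp only:)
  qed
  ultimately show ?thesis
    unfolding Hbar1_def [abs_def] A_eq c_def[symmetric] c'_def[symmetric] by (simp only:)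
qed

lemma E1_integrand:
  fixes I \<phi> :: "real ^ 'n::finite"
  assumes J: "I $ i \<noteq> 0"
  shows "(norm (grad (\<lambda>I. 1 / 2 * (norm (I + grad (u_n f i k I) \<phi>))\<^sup>2 - Hbar_n f i k I) I))\<^sup>2
      * sigma_n f i k I \<phi> = dens1 k (c_approx f k \<bar>I $ i\<bar>) (\<phi> $ i)"
proof -
  \<comment> \<open>The squares of the other momenta cancel against \<open>Hbar_n\<close>. As the
    set is open, this holds in a neighbourhood of \<open>I\<close>, as the gradient
    requires.\<close>
  have "open {y :: real ^ 'n. y $ i \<noteq> 0}"
    by (intro open_Collect_neq continuous_intros)
  then have "\<forall>\<^sub>F y in nhds I. y $ i \<noteq> 0"
    using eventually_nhds_in_open[of "{y. y $ i \<noteq> 0}" I] J by simp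
  then have "\<forall>\<^sub>F y in nhds I. 1 / 2 * (norm (y + grad (u_n f i k y) \<phi>))\<^sup>2 - Hbar_n f i k y
      = (G k (c_approx f k \<bar>y $ i\<bar>) (\<phi> $ i))\<^sup>2 / 2 - Hbar1 f k (y $ i)"
    by (rule eventually_mono)
      (simp add: norm_plus_grad_u_n Hbar_n_def sum_divide_distrib add_divide_distrib)
  note grad_eq = grad_coordinate[OF DERIV_residual[OF J] this]
  have "(sgn (I $ i))\<^sup>2 = 1"
    using J by (simp add: sgn_if)
  then show ?thesis
    unfolding grad_eq dens1_def sigma_n_eq norm_scaleR norm_axis_1 mult_1_right power2_abs power2_minus
      power_mult_distrib[of "sgn (I $ i)"] by simp
qed

lemma E1_inner_integral:
  fixes I :: "real ^ 'n::finite"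
  assumes J: "I $ i \<noteq> 0"
  shows "(\<integral>\<^sup>+\<phi>\<in>torus. ennreal ((norm (grad (\<lambda>I. 1 / 2 * (norm (I + grad (u_n f i k I) \<phi>))\<^sup>2
      - Hbar_n f i k I) I))\<^sup>2 * sigma_n f i k I \<phi>) \<partial>lborel)
    = ennreal ((2 * pi) ^ (CARD('n) - 1) * integral {0..2 * pi} (dens1 k (c_approx f k \<bar>I $ i\<bar>)))"
  unfolding E1_integrand[OF J]
  by (intro nn_integral_torus_coordinate continuous_on_dens1 dens_nonneg k)

text \<open>Along the first angle the root has derivative \<open>- f' * G * w\<close>, so half its
  square plus \<open>f\<close> has derivative \<open>f' * (1 - G\<^sup>2 * w)\<close>, which is
  \<open>f' * w / k\<close>.\<close>

lemma E2_eq: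
  fixes I :: "real ^ 'n::finite"
  assumes J: "0 < I $ i" and f': "\<And>x. (f has_real_derivative f' x) (at x)" "continuous_on UNIV f'"
  shows "E2 f i I k
    = ennreal ((2 * pi) ^ (CARD('n) - 1) * integral {0..2 * pi} (dens2 f' k (c_approx f k (I $ i))))"
proof -
  define c where "c = c_approx f k (I $ i)"
  define s where "s = (\<Sum>j\<in>UNIV - {i}. (I $ j)\<^sup>2)"
  have d: "((\<lambda>x. 1 / 2 * ((G k c x)\<^sup>2 + s) + f x) has_real_derivative
      1 / real k * f' x * w k c x) (at x)" for x
  proof -
    have "((\<lambda>x. soft_sqrt k (c - f x)) has_real_derivative
        (soft_sqrt k (c - f x) / ((soft_sqrt k (c - f x))\<^sup>2 + 1 / real k)) * (- f' x)) (at x)"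
      by (rule DERIV_chain2[OF DERIV_soft_sqrt[OF k]]) (auto intro!: derivative_eq_intros f'(1))
    then have "(G k c has_real_derivative (G k c x * w k c x) * (- f' x)) (at x)"
      by (simp add: gamma_eq_soft_sqrt [abs_def] w_def)
    then have "((\<lambda>x. 1 / 2 * ((G k c x)\<^sup>2 + s) + f x) has_real_derivative
        (G k c x)\<^sup>2 * w k c x * (- f' x) + f' x) (at x)"
      by (auto intro!: derivative_eq_intros f'(1) simp: power2_eq_square)
    then show ?thesis
      unfolding G_square_w[OF k] by (simp add: algebra_simps)
  qed
  have "(norm (grad (\<lambda>\<phi>. 1 / 2 * (norm (I + grad (u_n f i k I) \<phi>))\<^sup>2 + f (\<phi> $ i)) \<phi>))\<^sup>2
      * sigma_n f i k I \<phi> = dens2 f' k c (\<phi> $ i)" for \<phi>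
  proof -
    have "grad (\<lambda>\<phi>. 1 / 2 * (norm (I + grad (u_n f i k I) \<phi>))\<^sup>2 + f (\<phi> $ i)) \<phi>
        = (1 / real k * f' (\<phi> $ i) * w k c (\<phi> $ i)) *\<^sub>R axis i 1"
      by (rule grad_coordinate[OF d]) (use J in \<open>simp add: norm_plus_grad_u_n c_def s_def\<close>)
    then show ?thesis
      using J by (simp only: dens2_def sigma_n_eq c_def norm_scaleR norm_axis_1 mult_1_right power2_abs abs_of_pos)
  qed
  then show ?thesis
    unfolding E2_def c_def[symmetric]
    by (simp only:) (intro nn_integral_torus_coordinate continuous_on_dens2 dens_nonneg k
        continuous_on_subset[OF f'(2)] subset_UNIV)
qed

end

end

section \<open>The bounds for \<open>E1\<close> and \<open>E2\<close> in dimension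
  \<open>n\<close>\<close>

lemma AE_coordinate_nonzero: "AE x :: real ^ 'n::finite in lborel. x $ i \<noteq> 0"
proof (rule AE_I')
  have "closed {x :: real ^ 'n. x $ i = 0}"
    by (intro closed_Collect_eq continuous_intros)
  then show "{x :: real ^ 'n. x $ i = 0} \<in> null_sets lborel"
    using negligible_standard_hyperplane_cart[of i]
    by (simp add: negligible_iff_null_sets null_sets_completion_iff)
qed simp

context circle_potential
begin

text \<open>The ball is enclosed in a cube of side \<open>2 * R\<close>. Integrating
  \<open>dens1_upper\<close> over the first momentum gives \<open>2 * rate k R\<close>, at most
  \<open>2 * R\<close>, over \<open>k\<close>; the other momenta and angles contribute
  volumes.\<close>

lemma E1_upper:
  fixes i :: "'n::finite"
  assumes k: "0 < k" and R: "0 < R"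
  shows "E1 f i R k \<le> ennreal ((2 * R) ^ (CARD('n) - 1) * (2 * pi) ^ (CARD('n) - 1) * (2 * R) / real k)"
proof -
  \<comment> \<open>Continuity of \<open>rate'\<close> is available for positive momenta, so the
    null point \<open>0\<close> is removed to obtain measurability.\<close>
  define S where "S = {- R..R} - {0}"
  define a where "a = (2 * pi) ^ (CARD('n) - 1) / real k"
  define p where "p t = indicator S t * rate' k \<bar>t\<bar>" for t
  have a: "0 \<le> a"
    by (simp add: a_def)
  have "continuous_on S (\<lambda>t. rate' k \<bar>t\<bar>)"
    by (rule continuous_on_compose2[OF continuous_on_rate'[OF k]]) (auto simp: S_def intro!: continuous_intros)
  then have p [measurable]: "p \<in> borel_measurable borel"
    using borel_measurable_continuous_on_indicator[of S "\<lambda>t. rate' k \<bar>t\<bar>"] by (simp add: p_def [abs_def] S_def)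
  have p_nonneg: "0 \<le> p t" for t
    using rate'_nonneg[OF k] by (simp add: p_def)
  have "((\<lambda>t. rate' k \<bar>t\<bar>) has_integral 2 * rate k R) S
      \<longleftrightarrow> ((\<lambda>t. rate' k \<bar>t\<bar>) has_integral 2 * rate k R) {- R..R}"
    by (rule has_integral_spike_set_eq) (auto simp: S_def intro: negligible_subset[of "{0}"])
  with rate'_has_integral[OF k R] have "((\<lambda>t. rate' k \<bar>t\<bar>) has_integral 2 * rate k R) S"
    by simp
  then have int_p: "(\<integral>\<^sup>+t. ennreal (p t) \<partial>lborel) = ennreal (2 * rate k R)"
    unfolding p_def by (rule nn_integral_has_integral_lebesgue[rotated]) (rule rate'_nonneg[OF k])
  have "E1 f i R k \<le> (\<integral>\<^sup>+x. ennreal (a * p (x $ i)) *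
      indicator {x :: real ^ 'n. \<forall>j. j \<noteq> i \<longrightarrow> x $ j \<in> {- R..R}} x \<partial>lborel)"
    unfolding E1_def
  proof (rule nn_integral_mono_AE, rule AE_mp[OF AE_coordinate_nonzero[of i]], rule AE_I2, rule impI)
    fix I :: "real ^ 'n"
    assume I: "I $ i \<noteq> 0"
    have coord: "I $ j \<in> {- R..R}" if "norm I \<le> R" for j
      using component_le_norm_cart[of I j] that by auto
    have "(2 * pi) ^ (CARD('n) - 1) * integral {0..2 * pi} (dens1 k (c_approx f k \<bar>I $ i\<bar>))
        \<le> a * p (I $ i)" if "norm I \<le> R"
    proof -
      have "(2 * pi) ^ (CARD('n) - 1) * integral {0..2 * pi} (dens1 k (c_approx f k \<bar>I $ i\<bar>))
        \<le> (2 * pi) ^ (CARD('n) - 1) * (rate' k \<bar>I $ i\<bar> / real k)"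
        by (intro mult_left_mono dens1_upper k) simp
      also have "\<dots> = a * p (I $ i)"
        using coord[OF that, of i] I by (simp add: a_def p_def S_def)
      finally show ?thesis .
    qed
    then show "(\<integral>\<^sup>+\<phi>\<in>torus. ennreal ((norm (grad (\<lambda>I. 1 / 2 * (norm (I + grad (u_n f i k I) \<phi>))\<^sup>2
        - Hbar_n f i k I) I))\<^sup>2 * sigma_n f i k I \<phi>) \<partial>lborel) * indicator {I. norm I \<le> R} I
        \<le> ennreal (a * p (I $ i)) * indicator {x. \<forall>j. j \<noteq> i \<longrightarrow> x $ j \<in> {- R..R}} I"
      unfolding E1_inner_integral[OF k I] using coord
      by (auto simp: indicator_def intro!: ennreal_leI)
  qed
  also have "\<dots> = ennreal ((2 * R) ^ (CARD('n) - 1)) * (\<integral>\<^sup>+t. ennreal (a * p t) \<partial>lborel)"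
    using nn_integral_coordinate_box[of "\<lambda>t. a * p t" "- R" R i] p_nonneg a R by simp
  also have "(\<integral>\<^sup>+t. ennreal (a * p t) \<partial>lborel) = ennreal (a * (2 * rate k R))"
    using a p_nonneg int_p rate_pos[OF k, of R]
    by (simp add: ennreal_mult nn_integral_cmult less_imp_le)
  also have "\<dots> \<le> ennreal (a * (2 * R))"
    using a rate_le[OF k R] by (intro ennreal_leI mult_left_mono) auto
  also have "ennreal ((2 * R) ^ (CARD('n) - 1)) * ennreal (a * (2 * R))
      = ennreal ((2 * R) ^ (CARD('n) - 1) * (a * (2 * R)))"
    using R a by (intro ennreal_mult [symmetric]) auto
  also have "(2 * R) ^ (CARD('n) - 1) * (a * (2 * R))
      = (2 * R) ^ (CARD('n) - 1) * (2 * pi) ^ (CARD('n) - 1) * (2 * R) / real k"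
    by (simp add: a_def)
  finally show ?thesis
    by (simp add: mult_left_mono)
qed

text \<open>Leaves room below \<open>J\<close>: a smaller level still above \<open>fmax\<close>
  belongs to a smaller momentum, so the uniform bounds hold on an interval of momenta.\<close>

lemma total0_gap:
  assumes J: "0 < J" and gap: "fmax < c_limit f J"
  obtains c J' where "fmax < c" "0 < J'" "J' < J" "total0 c = 2 * pi * J'"
proof -
  define c where "c = (fmax + c_limit f J) / 2"
  have c: "fmax < c" "c < c_limit f J"
    using gap by (auto simp: c_def field_simps)
  have m: "fmin \<le> fmax"
    using fmin_le_f[of 0] f_le_fmax[of 0] by linarith
  have "total0 fmin < total0 c"
    using c m by (intro total0_strict_mono) auto
  moreover have "total0 c < total0 (c_limit f J)"
    using c m by (intro total0_strict_mono) auto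
  ultimately show ?thesis
    using c total0_c_limit[OF J] by (intro that[of c "total0 c / (2 * pi)"]) (auto simp: total0_eq_0 field_simps)
qed

lemma E1_lower:
  fixes i :: "'n::finite"
  assumes nonconst: "\<not> f constant_on UNIV" and R: "0 < R" and gap: "fmax < c_limit f R"
  obtains \<kappa> where "0 < \<kappa>" "\<forall>\<^sub>F k in sequentially. ennreal (\<kappa> / (real k)\<^sup>2) \<le> E1 f i R k"
proof -
  obtain c J where c: "fmax < c" and J: "0 < J" "J < R" "total0 c = 2 * pi * J"
    by (rule total0_gap[OF R gap])
  obtain l L where l: "0 < l" "1 \<le> L" and bounds: "\<forall>\<^sub>F k in sequentially. 0 < k \<and>
       (\<forall>J'\<in>{J..R}. \<forall>x. l \<le> G k (c_approx f k J') x \<and> G k (c_approx f k J') x \<le> L)"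
    by (rule G_uniform_bounds[OF c J(1) eq_refl[OF J(3)] less_imp_le[OF J(2)]])
  obtain \<kappa> where \<kappa>: "0 < \<kappa>" "\<And>k c. 0 < k \<Longrightarrow> (\<And>x. l \<le> G k c x \<and> G k c x \<le> L) \<Longrightarrow>
       \<kappa> / (real k)\<^sup>2 \<le> integral {0..2 * pi} (dens1 k c)"
    using dens1_lower[OF nonconst l] by blast
  \<comment> \<open>The box with first side \<open>{J..b}\<close> and other sides
    \<open>{- e..e}\<close> has to lie in the ball: its points have l1-norm at most
    \<open>b + n * e = R\<close>.\<close>
  define e where "e = (R - J) / (2 * CARD('n))"
  have e: "0 < e" "e * CARD('n) = (R - J) / 2"
    using J by (auto simp: e_def)
  define b where "b = (J + R) / 2"
  have b: "J < b" "b < R"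
    using J by (auto simp: b_def)
  have small: "norm I \<le> R"
    if I: "I $ i \<in> {J..b}" "\<And>j. j \<noteq> i \<Longrightarrow> I $ j \<in> {- e..e}" for I :: "real ^ 'n"
  proof -
    have "norm I \<le> (\<Sum>j\<in>UNIV. \<bar>I $ j\<bar>)"
      by (rule norm_le_l1_cart)
    also have "\<dots> = \<bar>I $ i\<bar> + (\<Sum>j\<in>UNIV - {i}. \<bar>I $ j\<bar>)"
      by (simp add: sum.remove[of _ i])
    also have "\<dots> \<le> b + (\<Sum>j\<in>UNIV - {i}. e)"
      using I J by (intro add_mono sum_mono) (auto simp: abs_le_iff minus_le_iff)
    also have "(\<Sum>j\<in>UNIV - {i}. e) \<le> (\<Sum>j\<in>(UNIV :: 'n set). e)"
      using e by (intro sum_mono2) auto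
    also have "b + (\<Sum>j\<in>(UNIV :: 'n set). e) = R"
      using e by (simp add: b_def mult.commute field_simps)
    finally show ?thesis by simp
  qed
  define \<kappa>' where "\<kappa>' = (2 * e) ^ (CARD('n) - 1) * ((2 * pi) ^ (CARD('n) - 1) * \<kappa> * (b - J))"
  have "0 < \<kappa>'"
    using e b \<kappa> by (simp add: \<kappa>'_def)
  moreover have "\<forall>\<^sub>F k in sequentially. ennreal (\<kappa>' / (real k)\<^sup>2) \<le> E1 f i R k"
    using bounds
  proof eventually_elim
    case (elim k)
    then have k: "0 < k" by simp
    define a where "a = (2 * pi) ^ (CARD('n) - 1) * (\<kappa> / (real k)\<^sup>2)"
    have a: "0 \<le> a"
      using \<kappa> by (simp add: a_def)
    define h where "h t = a * indicator {J..b} t" for t :: real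
    have "(\<integral>\<^sup>+t. ennreal (h t) \<partial>lborel) = ennreal (a * (b - J))"
      using a b by (simp add: h_def ennreal_mult ennreal_indicator nn_integral_cmult)
    moreover have "\<kappa>' / (real k)\<^sup>2 = (2 * e) ^ (CARD('n) - 1) * (a * (b - J))"
      by (simp add: \<kappa>'_def a_def)
    ultimately have "ennreal (\<kappa>' / (real k)\<^sup>2)
        = ennreal ((2 * e) ^ (CARD('n) - 1)) * (\<integral>\<^sup>+t. ennreal (h t) \<partial>lborel)"
      using e a b by (simp only:) (intro ennreal_mult mult_nonneg_nonneg zero_le_power; simp)
    also have "\<dots> = (\<integral>\<^sup>+x. ennreal (h (x $ i)) *
        indicator {x :: real ^ 'n. \<forall>j. j \<noteq> i \<longrightarrow> x $ j \<in> {- e..e}} x \<partial>lborel)"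
      using nn_integral_coordinate_box[of h "- e" e i] a e by (simp add: h_def [abs_def])
    also have "\<dots> \<le> E1 f i R k"
      unfolding E1_def
    proof (rule nn_integral_mono)
      fix I :: "real ^ 'n"
      show "ennreal (h (I $ i)) * indicator {x :: real ^ 'n. \<forall>j. j \<noteq> i \<longrightarrow> x $ j \<in> {- e..e}} I
        \<le> (\<integral>\<^sup>+\<phi>\<in>torus. ennreal ((norm (grad (\<lambda>I. 1 / 2 * (norm (I + grad (u_n f i k I) \<phi>))\<^sup>2
            - Hbar_n f i k I) I))\<^sup>2 * sigma_n f i k I \<phi>) \<partial>lborel) * indicator {I. norm I \<le> R} I"
      proof (cases "I $ i \<in> {J..b} \<and> (\<forall>j. j \<noteq> i \<longrightarrow> I $ j \<in> {- e..e})")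
        case True
        then have I: "I $ i \<noteq> 0" "\<bar>I $ i\<bar> \<in> {J..R}" "norm I \<le> R"
          using J b small[of I] by auto
        have "a \<le> (2 * pi) ^ (CARD('n) - 1) * integral {0..2 * pi} (dens1 k (c_approx f k \<bar>I $ i\<bar>))"
          unfolding a_def using elim I by (intro mult_left_mono \<kappa>) auto
        then show ?thesis
          using True I unfolding E1_inner_integral[OF k I(1)]
          by (auto simp: h_def indicator_def intro!: ennreal_leI)
      next
        case False
        then show ?thesis
          by (auto simp: h_def indicator_def)
      qed
    qed
    finally show ?case .
  qed
  ultimately show ?thesis
    by (rule that)
qed

lemma integral_deriv_square_pos:
  assumes nonconst: "\<not> f constant_on UNIV"
    and f': "\<And>x. (f has_real_derivative f' x) (at x)" "continuous_on UNIV f'"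
  shows "0 < integral {0..2 * pi} (\<lambda>x. (f' x)\<^sup>2)"
proof -
  have cont: "continuous_on {0..2 * pi} (\<lambda>x. (f' x)\<^sup>2)"
    by (intro continuous_intros continuous_on_subset[OF f'(2)]) simp
  have "integral {0..2 * pi} (\<lambda>x. (f' x)\<^sup>2) \<noteq> 0"
  proof
    assume "integral {0..2 * pi} (\<lambda>x. (f' x)\<^sup>2) = 0"
    then have zero: "f' x = 0" if "x \<in> {0..2 * pi}" for x
      using integral_eq_0_iff[OF cont] that by simp
    have "f x = f 0" if "x \<in> {0..2 * pi}" for x
    proof (rule DERIV_isconst2[where f = f and a = 0 and b = "2 * pi"])
      show "continuous_on {0..2 * pi} f"
        by (rule continuous_on_subset[OF continuous_f]) simp
      show "(f has_real_derivative 0) (at y)" if "0 < y" "y < 2 * pi" for y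
        using f'(1)[of y] zero[of y] that by simp
    qed (use that in auto)
    then have "range f \<subseteq> {f 0}"
      unfolding range_f by blast
    then have "f constant_on UNIV"
      unfolding constant_on_def by (intro exI[of _ "f 0"]) (simp add: image_subset_iff)
    with nonconst show False by contradiction
  qed
  moreover have "0 \<le> integral {0..2 * pi} (\<lambda>x. (f' x)\<^sup>2)"
    by (intro integral_nonneg integrable_continuous_interval cont) simp
  ultimately show ?thesis by simp
qed

text \<open>For fixed \<open>I\<close> above the critical level, \<open>w\<close> stays between
  positive constants, so both bounds have order \<open>1 / k\<^sup>2\<close>. Their constants depend
  on \<open>I\<close> through \<open>l\<close> and \<open>L\<close>.\<close>

lemma E2_bounds:
  fixes I :: "real ^ 'n::finite"
  assumes nonconst: "\<not> f constant_on UNIV"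
    and f': "\<And>x. (f has_real_derivative f' x) (at x)" "continuous_on UNIV f'"
    and I: "0 < I $ i" and gap: "fmax < c_limit f (I $ i)"
  obtains \<kappa> K where "0 < \<kappa>"
    "\<forall>\<^sub>F k in sequentially. ennreal (\<kappa> / (real k)\<^sup>2) \<le> E2 f i I k \<and> E2 f i I k \<le> ennreal (K / (real k)\<^sup>2)"
proof -
  obtain c J where c: "fmax < c" and J: "0 < J" "J < I $ i" "total0 c = 2 * pi * J"
    by (rule total0_gap[OF I gap])
  obtain l L where l: "0 < l" "1 \<le> L" and bounds: "\<forall>\<^sub>F k in sequentially. 0 < k \<and>
       (\<forall>J'\<in>{J..I $ i}. \<forall>x. l \<le> G k (c_approx f k J') x \<and> G k (c_approx f k J') x \<le> L)"
    by (rule G_uniform_bounds[OF c J(1) eq_refl[OF J(3)] less_imp_le[OF J(2)]])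
  have "compact (f' ` {0..2 * pi})"
    by (intro compact_continuous_image continuous_on_subset[OF f'(2)]) auto
  then obtain M where "\<forall>x\<in>{0..2 * pi}. \<bar>f' x\<bar> \<le> M"
    using compact_imp_bounded[of "f' ` {0..2 * pi}"] unfolding bounded_iff by auto
  then have M: "\<And>x. x \<in> {0..2 * pi} \<Longrightarrow> \<bar>f' x\<bar> \<le> M"
    by blast
  define P where "P = (2 * pi) ^ (CARD('n) - 1)"
  define \<kappa> where "\<kappa> = P * ((1 / (L\<^sup>2 + 1))\<^sup>2 * (l / (2 * pi * L)) * integral {0..2 * pi} (\<lambda>x. (f' x)\<^sup>2))"
  define K where "K = P * (M / l\<^sup>2)\<^sup>2"
  have P: "0 < P"
    by (simp add: P_def)
  have "0 < L\<^sup>2 + 1"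
    by (simp add: add_nonneg_pos)
  then have "0 < \<kappa>"
    unfolding \<kappa>_def using P l integral_deriv_square_pos[OF nonconst f']
    by (intro mult_pos_pos zero_less_power divide_pos_pos) auto
  moreover have "\<forall>\<^sub>F k in sequentially.
      ennreal (\<kappa> / (real k)\<^sup>2) \<le> E2 f i I k \<and> E2 f i I k \<le> ennreal (K / (real k)\<^sup>2)"
    using bounds
  proof eventually_elim
    case (elim k)
    then have k: "0 < k" by simp
    define cJ where "cJ = c_approx f k (I $ i)"
    have G: "l \<le> G k cJ x" "G k cJ x \<le> L" for x
      using elim J by (auto simp: cJ_def)
    note b = dens2_bounds[OF k l G f'(2) M]
    have "\<kappa> / (real k)\<^sup>2 \<le> P * integral {0..2 * pi} (dens2 f' k cJ)"
      using mult_left_mono[OF b(1), of P] P by (simp add: \<kappa>_def)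
    moreover have "P * integral {0..2 * pi} (dens2 f' k cJ) \<le> K / (real k)\<^sup>2"
      using mult_left_mono[OF b(2), of P] P by (simp add: K_def)
    ultimately show ?case
      unfolding E2_eq[of k I i f', OF k I f'] P_def cJ_def by (auto intro: ennreal_leI)
  qed
  ultimately show ?thesis
    by (rule that)
qed

end

theorem mainTheorem5:
  fixes f :: "real \<Rightarrow> real" and i1 :: "'n::finite" and R :: real
  assumes "C2_circle f"
    and "\<not> f constant_on UNIV"
    and "R > 0"
    and "c_limit f R > (SUP x. f x)"
  shows "(\<exists>cR CR. cR > 0 \<and> CR > 0 \<and>
            (\<forall>\<^sub>F k in sequentially.
               ennreal (cR / (real k)\<^sup>2) \<le> E1 f i1 R k \<and> E1 f i1 R k \<le> ennreal (CR / real k)))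
       \<and> (\<exists>CR. CR > 0 \<and>
            (\<forall>I :: real ^ 'n. norm I \<le> R \<and> I $ i1 > 0 \<and> c_limit f (I $ i1) > (SUP x. f x) \<longrightarrow>
               (\<exists>cI. cI > 0 \<and>
                  (\<forall>\<^sub>F k in sequentially.
                     ennreal (cI / (real k)\<^sup>2) \<le> E2 f i1 I k \<and> E2 f i1 I k \<le> ennreal (CR / real k)))))"
proof (rule conjI)
  obtain f' where f': "\<And>x. (f has_real_derivative f' x) (at x)" "continuous_on UNIV f'"
    using assms(1) unfolding C2_circle_def C1_differentiable_on_def
    by (auto simp: has_real_derivative_iff_has_vector_derivative)
  interpret circle_potential f
  proof
    show "continuous_on UNIV f"
      by (meson f'(1) DERIV_isCont continuous_at_imp_continuous_on)
  qed (use assms(1) in \<open>simp add: C2_circle_def\<close>)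
  note gap = assms(4)[folded fmax_def]
  show "\<exists>cR CR. cR > 0 \<and> CR > 0 \<and> (\<forall>\<^sub>F k in sequentially.
      ennreal (cR / (real k)\<^sup>2) \<le> E1 f i1 R k \<and> E1 f i1 R k \<le> ennreal (CR / real k))"
  proof -
    obtain \<kappa> where \<kappa>: "0 < \<kappa>" "\<forall>\<^sub>F k in sequentially. ennreal (\<kappa> / (real k)\<^sup>2) \<le> E1 f i1 R k"
      by (rule E1_lower[OF assms(2,3) gap])
    define K where "K = (2 * R) ^ (CARD('n) - 1) * (2 * pi) ^ (CARD('n) - 1) * (2 * R)"
    have "0 < K"
      using assms(3) by (simp add: K_def)
    moreover have "\<forall>\<^sub>F k in sequentially.
        ennreal (\<kappa> / (real k)\<^sup>2) \<le> E1 f i1 R k \<and> E1 f i1 R k \<le> ennreal (K / real k)"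
      using \<kappa>(2) eventually_gt_at_top[of 0]
    proof eventually_elim
      case (elim k)
      then show ?case
        using E1_upper[OF _ assms(3), of k i1] unfolding K_def by blast
    qed
    ultimately show ?thesis
      using \<kappa>(1) by blast
  qed
  text \<open>The constant \<open>1\<close> suffices in the upper bound, since \<open>E2\<close> is in fact of order \<open>1 / k\<^sup>2\<close>
    for each fixed \<open>I\<close> above the critical level.\<close>
  have "\<exists>cI. cI > 0 \<and> (\<forall>\<^sub>F k in sequentially.
      ennreal (cI / (real k)\<^sup>2) \<le> E2 f i1 I k \<and> E2 f i1 I k \<le> ennreal (1 / real k))"
    if "norm I \<le> R \<and> I $ i1 > 0 \<and> c_limit f (I $ i1) > (SUP x. f x)" for I :: "real ^ 'n"
  proof -
    from that have I: "0 < I $ i1" "fmax < c_limit f (I $ i1)"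
      by (auto simp: fmax_def)
    obtain \<kappa> K where \<kappa>: "0 < \<kappa>" and E2: "\<forall>\<^sub>F k in sequentially.
        ennreal (\<kappa> / (real k)\<^sup>2) \<le> E2 f i1 I k \<and> E2 f i1 I k \<le> ennreal (K / (real k)\<^sup>2)"
      by (rule E2_bounds[OF assms(2) f' I])
    \<comment> \<open>The dependence of \<open>K\<close> on \<open>I\<close> moves into the
      threshold for \<open>k\<close>: once \<open>k > N\<close>, the bound
      \<open>K / k\<^sup>2\<close> is at most \<open>1 / k\<close>.\<close>
    obtain N :: nat where N: "K \<le> real N"
      using real_arch_simple by blast
    have "\<forall>\<^sub>F k in sequentially.
        ennreal (\<kappa> / (real k)\<^sup>2) \<le> E2 f i1 I k \<and> E2 f i1 I k \<le> ennreal (1 / real k)"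
      using E2 eventually_gt_at_top[of N]
    proof eventually_elim
      case (elim k)
      then have "K / (real k)\<^sup>2 \<le> 1 / real k"
        using N by (simp add: field_simps power2_eq_square)
      with elim(1) show ?case
        by (meson ennreal_leI order_trans)
    qed
    with \<kappa> show ?thesis by blast
  qed
  then show "\<exists>CR. CR > 0 \<and>
      (\<forall>I :: real ^ 'n. norm I \<le> R \<and> I $ i1 > 0 \<and> c_limit f (I $ i1) > (SUP x. f x) \<longrightarrow>
         (\<exists>cI. cI > 0 \<and> (\<forall>\<^sub>F k in sequentially.
            ennreal (cI / (real k)\<^sup>2) \<le> E2 f i1 I k \<and> E2 f i1 I k \<le> ennreal (CR / real k))))"
    by (intro exI[of _ 1]) simp
qed

end
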